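(* Let $n\ge 7$ and let $\mathcal{L}=\mathcal{A}-\binom{n-3}{3}\mathcal{I}$ be the classical Laplacian of the Kneser graph $\Gamma(n,3,0)$. Set $$X=\gcd\left(\frac{(n-4)(n-5)n}{3},\ \frac{(n^2-7n+18)(n-5)}{6},\ \frac{(n^2-10n+27)(n-2)(n-4)(n-5)n}{36}\right),$$ $$Y=\gcd\left(n-5,\ \frac{3(n-4)(n-5)}{2},\ \frac{(n-1)(n-3)(n-5)}{3}\right).$$ Then $\mathcal{L}$ has a diagonal form whose diagonal entries are exactly the following (with multiplicities added together when the same integer occurs more than once in the list): (1) $\frac16(n^2-10n+27)(n-2)$ with multiplicity $\binom{n}{3}-2\binom{n}{2}+n$; (2) $\frac1{36}(n^2-10n+27)(n-1)(n-2)(n-5)(n-6)$ with multiplicity $\binom{n}{2}-2n+1$; (3) $1$ with multiplicity $\binom{n}{2}-n$; (4) $\frac{1}{X}\cdot\frac{1}{216}(n^2-10n+27)(n-1)(n-2)(n-4)(n-5)^2(n-6)n$ with multiplicity $n-2$, and $X$ with multiplicity $n-2$; (5) $\frac1Y\cdot\frac1{36}(n^2-10n+27)(n-4)(n-5)^2(n-6)$ with multiplicity $1$, and $Y$ with multiplicity $1$; (6) $0$ with multiplicity $1$.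
   Context: The graph $\Gamma(n,k,\ell)$ has as vertices the $k$-element subsets of $\{1,\dots,n\}$, two of them adjacent when they intersect in exactly $\ell$ elements; $\mathcal{A}$ denotes its adjacency matrix and $\mathcal{I}$ the identity matrix of the same size. For $k=3,\ell=0$ every vertex has degree $d=\binom{n-3}{3}$, and the classical Laplacian is taken to be $\mathcal{A}-d\mathcal{I}$. A unimodular matrix is a square integer matrix with an integer inverse. A diagonal form of an integer matrix $M$ is a matrix $D$ of the same dimensions as $M$, with $(i,j)$-entry $0$ unless $i=j$, such that $EMF=D$ for some unimodular matrices $E,F$. *)

theory Defs
  imports "Jordan_Normal_Form.Matrix" "HOL-Library.Multiset"
begin

definition Gamma_vertices :: "nat \<Rightarrow> nat \<Rightarrow> nat set set" where
  "Gamma_vertices n k = {S. S \<subseteq> {1..n} \<and> card S = k}"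

definition Gamma_adj :: "nat \<Rightarrow> nat set \<Rightarrow> nat set \<Rightarrow> bool" where
  "Gamma_adj l S T \<longleftrightarrow> S \<noteq> T \<and> card (S \<inter> T) = l"

text \<open>
  Rows and columns of the adjacency matrix are indexed by positions in a list \<open>vs\<close>,
  which is meant to enumerate the vertices of \<open>\<Gamma>(n,k,l)\<close> without repetition.
\<close>

definition Gamma_enum :: "nat \<Rightarrow> nat \<Rightarrow> nat set list \<Rightarrow> bool" where
  "Gamma_enum n k vs \<longleftrightarrow> distinct vs \<and> set vs = Gamma_vertices n k"

definition Gamma_adj_mat :: "nat \<Rightarrow> nat set list \<Rightarrow> int mat" where
  "Gamma_adj_mat l vs =
     mat (length vs) (length vs) (\<lambda>(i, j). if Gamma_adj l (vs ! i) (vs ! j) then 1 else 0)"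

definition Kneser3_laplacian :: "nat \<Rightarrow> nat set list \<Rightarrow> int mat" where
  "Kneser3_laplacian n vs =
     Gamma_adj_mat 0 vs - int ((n - 3) choose 3) \<cdot>\<^sub>m 1\<^sub>m (length vs)"

text \<open>
  Over the integers, \<^const>\<open>invertible_mat\<close> says that the matrix is square and has a
  two-sided inverse with integer entries.
\<close>

definition unimodular_mat :: "int mat \<Rightarrow> bool" where
  "unimodular_mat E \<longleftrightarrow> invertible_mat E"

definition diagonal_form :: "int mat \<Rightarrow> int mat \<Rightarrow> bool" where
  "diagonal_form M D \<longleftrightarrow>
     D \<in> carrier_mat (dim_row M) (dim_col M) \<and> diagonal_mat D \<and>
     (\<exists>E F. E \<in> carrier_mat (dim_row M) (dim_row M) \<and> unimodular_mat E \<and>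
            F \<in> carrier_mat (dim_col M) (dim_col M) \<and> unimodular_mat F \<and>
            E * M * F = D)"

text \<open>
  All integer divisions in the next two definitions are exact, as the lemmas after them show.
\<close>

definition Kneser3_X :: "int \<Rightarrow> int" where
  "Kneser3_X n =
     gcd ((n - 4) * (n - 5) * n div 3)
         (gcd ((n^2 - 7*n + 18) * (n - 5) div 6)
              ((n^2 - 10*n + 27) * (n - 2) * (n - 4) * (n - 5) * n div 36))"

definition Kneser3_Y :: "int \<Rightarrow> int" where
  "Kneser3_Y n =
     gcd (n - 5)
         (gcd (3 * (n - 4) * (n - 5) div 2)
              ((n - 1) * (n - 3) * (n - 5) div 3))"

lemma three_dvd_prod3:
  fixes a b c :: int
  assumes "a mod 3 = 0 \<or> b mod 3 = 0 \<or> c mod 3 = 0"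
  shows "3 dvd a * b * c"
  using assms by (auto simp: dvd_eq_mod_eq_0[symmetric] intro: dvd_mult dvd_mult2)

lemma Kneser3_X_exact_1: "3 dvd (n - 4) * (n - 5) * (n::int)"
  by (rule three_dvd_prod3) presburger

lemma Kneser3_X_exact_2: "6 dvd (n^2 - 7*n + 18) * (n - 5 :: int)"
proof -
  have "2 dvd (n^2 - 7*n + 18) * (n - 5)"
    by simp
  moreover have "3 dvd (n - 1) * n * (n - 5)"
    by (rule three_dvd_prod3) presburger
  then have "3 dvd (n - 1) * n * (n - 5) + 3 * ((6 - 2*n) * (n - 5))"
    by (intro dvd_add dvd_triv_left)
  then have "3 dvd (n^2 - 7*n + 18) * (n - 5)"
    by (simp add: algebra_simps power2_eq_square)
  moreover have "6 dvd x" if "2 dvd x" "3 dvd x" for x :: int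
    using that by presburger
  ultimately show ?thesis
    by blast
qed

lemma Kneser3_X_exact_3:
  "36 dvd (n^2 - 10*n + 27) * (n - 2) * (n - 4) * (n - 5) * (n::int)"
proof -
  let ?P = "(n^2 - 10*n + 27) * (n - 2) * (n - 4) * (n - 5) * n"
  have "3 dvd (n - 1) * n * (n - 2)"
    by (rule three_dvd_prod3) presburger
  then have "3 dvd (n - 1) * n * (n - 2) + 3 * ((9 - 3*n) * (n - 2))"
    by (intro dvd_add dvd_triv_left)
  then have "3 dvd (n^2 - 10*n + 27) * (n - 2)"
    by (simp add: algebra_simps power2_eq_square)
  then have "3 * 3 dvd ((n^2 - 10*n + 27) * (n - 2)) * ((n - 4) * (n - 5) * n)"
    by (intro mult_dvd_mono Kneser3_X_exact_1)
  then have 9: "9 dvd ?P"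
    by (simp add: mult_ac)
  have 4: "4 dvd ?P"
  proof (cases "even n")
    case True
    then have "2 * 2 dvd (n - 2) * n"
      by (intro mult_dvd_mono) auto
    then have "2 * 2 dvd ((n - 2) * n) * ((n^2 - 10*n + 27) * (n - 4) * (n - 5))"
      by (rule dvd_mult2)
    then show ?thesis
      by (simp add: mult_ac)
  next
    case False
    then have "2 * 2 dvd (n^2 - 10*n + 27) * (n - 5)"
      by (intro mult_dvd_mono) auto
    then have "2 * 2 dvd ((n^2 - 10*n + 27) * (n - 5)) * ((n - 2) * (n - 4) * n)"
      by (rule dvd_mult2)
    then show ?thesis
      by (simp add: mult_ac)
  qed
  have "36 dvd x" if "9 dvd x" "4 dvd x" for x :: int
    using that by presburger
  with 9 4 show ?thesis
    by blast
qed

lemma Kneser3_Y_exact_1: "2 dvd 3 * (n - 4) * (n - 5 :: int)"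
  by simp

lemma Kneser3_Y_exact_2: "3 dvd (n - 1) * (n - 3) * (n - 5 :: int)"
  by (rule three_dvd_prod3) presburger

text \<open>
  The prescribed diagonal entries, as a multiset of rationals: the divisions by \<open>X\<close> and \<open>Y\<close>
  (and by 6, 36, 216) are carried out in the rationals, so equating the
  entries of an integer matrix with this multiset asserts in particular that all of them are
  integers.  The subtractions in the multiplicities are on natural numbers, written with
  the subtracted term last; they do not truncate for \<open>n \<ge> 7\<close>.
\<close>

definition Kneser3_entries :: "nat \<Rightarrow> rat multiset" where
  "Kneser3_entries m =
    (let n = rat_of_nat m;
         X = rat_of_int (Kneser3_X (int m));
         Y = rat_of_int (Kneser3_Y (int m))
     in replicate_mset ((m choose 3) + m - 2 * (m choose 2))
          (1/6 * (n^2 - 10*n + 27) * (n - 2))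
      + replicate_mset ((m choose 2) + 1 - 2 * m)
          (1/36 * (n^2 - 10*n + 27) * (n - 1) * (n - 2) * (n - 5) * (n - 6))
      + replicate_mset ((m choose 2) - m) 1
      + replicate_mset (m - 2)
          (1/X * (1/216) * (n^2 - 10*n + 27) * (n - 1) * (n - 2) * (n - 4) * (n - 5)^2
             * (n - 6) * n)
      + replicate_mset (m - 2) X
      + replicate_mset 1 (1/Y * (1/36) * (n^2 - 10*n + 27) * (n - 4) * (n - 5)^2 * (n - 6))
      + replicate_mset 1 Y
      + replicate_mset 1 0)"

end

theory Submission
  imports Defs "HOL-Library.Function_Algebras" "Jordan_Normal_Form.Determinant"
    "HOL-Computational_Algebra.Primes"
begin

text \<open>
  For \<open>R\<close> of size at most 3 let \<open>w R\<close> be the indicator function of the triples that contain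
  \<open>R\<close>. By inclusion and exclusion the Laplacian maps \<open>w R\<close> to
  \<open>- \<theta>\<^sub>j * w R\<close>, where \<open>j = card R\<close>, plus a combination of \<open>w R'\<close> with
  \<open>R' \<subset> R\<close>. Here \<open>\<theta>\<^sub>0 = 0\<close>, and the negatives of the \<open>\<theta>\<^sub>j\<close> are the
  eigenvalues. The idea of the proof is to split the lattice of integer functions on triples, for
  all \<open>n\<close> at once, into invariant sublattices of rank 1, 2, 3 and 4, on each of which the
  Laplacian is an explicit triangular matrix, and to diagonalise these small matrices.

  To find the sublattices, read \<open>w R\<close> for a triple \<open>R\<close> as the monomial that is the
  product of the variables \<open>x\<^sub>i\<close> with \<open>i \<in> R\<close>. On a polynomial of degree 3 the Laplacian depends, up to a
  multiple of the polynomial itself, only on its image under the formal derivative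
  \<open>\<partial>\<close>, the sum of all partial derivatives. So products of differences are the vectors of
  choice. Differences with a fixed point, \<open>x\<^sub>i - x\<^sub>1\<close>, give bases over the
  integers, but their products contain powers of \<open>x\<^sub>1\<close>, which are not monomials on
  sets. They are replaced by combinations of monomials with the right derivatives: \<open>x\<^sub>1\<^sup>2\<close>
  by \<open>x\<^sub>1 x\<^sub>2 + x\<^sub>1 x\<^sub>3 - x\<^sub>2 x\<^sub>3\<close>, whose derivative is
  \<open>2 x\<^sub>1\<close>, and similarly
  \<open>x\<^sub>1\<^sup>2 x\<^sub>j\<close> and \<open>x\<^sub>1\<^sup>3\<close> by combinations with derivatives
  \<open>2 x\<^sub>1 x\<^sub>j + x\<^sub>1\<^sup>2\<close> and \<open>3 x\<^sub>1\<^sup>2\<close>. Writing \<open>up f\<close> for the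
  combination of the \<open>w R\<close> that corresponds to a polynomial \<open>f\<close> of degree at most
  2, the invariant sublattices are spanned by

  \<^item> \<open>(x\<^sub>i - x\<^sub>1) (x\<^sub>j - x\<^sub>1) (x\<^sub>k - x\<^sub>1)\<close>, an eigenvector for \<open>- \<theta>\<^sub>3\<close>;
  \<^item> \<open>x\<^sub>1 f\<close> and \<open>up f\<close> for \<open>f = (x\<^sub>i - x\<^sub>1) (x\<^sub>j - x\<^sub>1)\<close>;
  \<^item> \<open>x\<^sub>1\<^sup>2 f\<close>, \<open>up (x\<^sub>1 f)\<close> and \<open>up f\<close> for \<open>f = x\<^sub>a - x\<^sub>1\<close>;
  \<^item> \<open>x\<^sub>1\<^sup>3\<close>, \<open>up x\<^sub>1\<^sup>2\<close>, \<open>up x\<^sub>1\<close> and \<open>up 1\<close>.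

  In each matrix except those of rank 1 some entry is a unit. Eliminating it leaves
  \<open>\<theta>\<^sub>2 \<theta>\<^sub>3\<close> in rank 2 and a two by two matrix with determinant
  \<open>\<theta>\<^sub>1 \<theta>\<^sub>2 \<theta>\<^sub>3\<close> in rank 3, whose entries have greatest common divisor
  \<open>X\<close>. In rank 4 it leaves two rows of length 3 and a zero row; as the Laplacian is
  symmetric and kills the constants, its image is orthogonal to the constants, which removes one
  more column, and the entries of the remaining two by two matrix have greatest common divisor
  \<open>Y\<close>. A nonsingular two by two integer matrix has the diagonal form given by the greatest common
  divisor of its entries and its determinant divided by that (\<open>smith_form_rank_two\<close>).

  It remains to choose the index sets so that the vectors form a basis of the lattice
  (\<open>spanning\<close> and the three lemmas on cardinalities): the triples, pairs and points are taken
  from \<open>{2..n - 1}\<close>, without the pairs \<open>{2, 3}\<close> and \<open>{5, 6}\<close>, without the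
  triples containing one of these, and without the triples inside \<open>{2..6}\<close>. Their number is
  right, and for a family of the right size spanning is enough, since a square integer matrix with
  a right inverse is unimodular.
\<close>

section \<open>Diagonal forms from spanning families\<close>

text \<open>
  The integral span is the span in a module over the integers. The simplification rule
  \<open>scale_scale\<close> of modules collects integer factors; it undoes the rules that move
  \<open>of_int\<close> inside products and loops with them.
\<close>

interpretation zmod: Modules.module "\<lambda>(c::int) (x::'a::comm_ring_1). of_int c * x"
  by unfold_locales (simp_all add: algebra_simps)

declare zmod.scale_scale [simp del]

abbreviation zspan :: "'a::comm_ring_1 set \<Rightarrow> 'a set" where
  "zspan \<equiv> zmod.span"

lemma of_int_fun_apply [simp]:
  "(of_int c :: 'a \<Rightarrow> 'b::comm_ring_1) x = of_int c"
proof (cases c)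
  case (nonneg k)
  then show ?thesis by simp
next
  case (neg k)
  then have "(of_int c :: 'a \<Rightarrow> 'b) = - of_nat (Suc k)" by simp
  then show ?thesis using neg by (simp del: of_nat_Suc)
qed

lemma zspan_of_int_mult: "x \<in> zspan S \<Longrightarrow> of_int c * x \<in> zspan S"
  by (rule zmod.span_scale)

text \<open>
  Over a commutative ring the determinant of a matrix with a right inverse is a unit, so the
  adjugate supplies the two-sided inverse.
\<close>

lemma right_inverse_imp_left_inverse_mat:
  fixes A B :: "'a::comm_ring_1 mat"
  assumes A: "A \<in> carrier_mat n n" and B: "B \<in> carrier_mat n n" and AB: "A * B = 1\<^sub>m n"
  shows "B * A = 1\<^sub>m n"
proof -
  note adj = adj_mat[OF A]
  have dets: "det A * det B = 1"
    using det_mult[OF A B] AB by simp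
  have "adj_mat A = adj_mat A * (A * B)"
    using adj A AB by simp
  also have "\<dots> = (adj_mat A * A) * B"
    using adj(1) A B by (simp only: assoc_mult_mat[of "adj_mat A" n n A n B n])
  also have "\<dots> = det A \<cdot>\<^sub>m B"
    using adj(3) B by (simp add: mult_smult_assoc_mat[of "1\<^sub>m n" n n B n])
  finally have "det A \<cdot>\<^sub>m (B * A) = det A \<cdot>\<^sub>m 1\<^sub>m n"
    using adj A B by (simp add: mult_smult_assoc_mat[of _ n n _ n, symmetric])
  then have "det B \<cdot>\<^sub>m (det A \<cdot>\<^sub>m (B * A)) = det B \<cdot>\<^sub>m (det A \<cdot>\<^sub>m 1\<^sub>m n)" 
    by simp
  moreover have "det B \<cdot>\<^sub>m (det A \<cdot>\<^sub>m M) = M" for M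
    using dets by (intro eq_matI) (simp_all add: mult.assoc[symmetric] mult.commute)
  ultimately show ?thesis by simp
qed

definition column_mat :: "'v list \<Rightarrow> ('v \<Rightarrow> int) list \<Rightarrow> int mat" where
  "column_mat vs fs = mat (length vs) (length fs) (\<lambda>(i, j). (fs ! j) (vs ! i))"

text \<open>
  The coefficients that express the unit vectors in a spanning family are the columns of a right
  inverse. So for a family of the right size spanning alone makes the matrix unimodular.
\<close>

lemma column_mat_invertible:
  assumes "distinct vs" and len: "length fs = length vs"
    and span: "\<And>v. v \<in> set vs \<Longrightarrow> (\<lambda>u. of_bool (u = v)) \<in> zspan (set fs)"
  obtains X where "X \<in> carrier_mat (length vs) (length vs)"
    "column_mat vs fs * X = 1\<^sub>m (length vs)" "X * column_mat vs fs = 1\<^sub>m (length vs)"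
proof -
  let ?N = "length vs"
  let ?T = "{f. \<exists>x. \<forall>u. f u = (\<Sum>j<?N. x j * (fs ! j) u)}"
  have "zmod.subspace ?T"
  proof (rule zmod.subspaceI)
    have "\<forall>u. (0 :: 'a \<Rightarrow> int) u = (\<Sum>j<?N. 0 * (fs ! j) u)" by simp
    then show "0 \<in> ?T" by (intro CollectI exI[of _ "\<lambda>_. 0"])
  next
    fix f g assume "f \<in> ?T" "g \<in> ?T"
    then obtain x y where "\<And>u. f u = (\<Sum>j<?N. x j * (fs ! j) u)" "\<And>u. g u = (\<Sum>j<?N. y j * (fs ! j) u)"
      by blast
    then have "\<forall>u. (f + g) u = (\<Sum>j<?N. (x j + y j) * (fs ! j) u)"
      by (simp add: sum.distrib algebra_simps)
    then show "f + g \<in> ?T" by (intro CollectI exI[of _ "\<lambda>j. x j + y j"])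
  next
    fix c :: int and f assume "f \<in> ?T"
    then obtain x where "\<And>u. f u = (\<Sum>j<?N. x j * (fs ! j) u)"
      by blast
    then have "\<forall>u. (of_int c * f) u = (\<Sum>j<?N. (c * x j) * (fs ! j) u)"
      by (simp add: sum_distrib_left mult.assoc)
    then show "of_int c * f \<in> ?T" by (intro CollectI exI[of _ "\<lambda>j. c * x j"])
  qed
  moreover have "set fs \<subseteq> ?T"
  proof
    fix f assume "f \<in> set fs"
    then obtain k where k: "k < ?N" "f = fs ! k"
      using len by (metis in_set_conv_nth)
    have "\<forall>u. f u = (\<Sum>j<?N. of_bool (j = k) * (fs ! j) u)"
      using k by simp
    then show "f \<in> ?T" by (intro CollectI exI[of _ "\<lambda>j. of_bool (j = k)"])
  qed
  ultimately have sub: "zspan (set fs) \<subseteq> ?T"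
    by (rule zmod.span_minimal[rotated])
  have "\<exists>x. \<forall>u. of_bool (u = v) = (\<Sum>j<?N. x j * (fs ! j) u)" if "v \<in> set vs" for v
    using span[OF that] sub by fastforce
  then obtain x where x: "\<And>u v. v \<in> set vs \<Longrightarrow> of_bool (u = v) = (\<Sum>j<?N. x v j * (fs ! j) u)"
    by metis
  define X where "X = mat ?N ?N (\<lambda>(j, k). x (vs ! k) j)"
  have X: "X \<in> carrier_mat ?N ?N" by (simp add: X_def)
  have C: "column_mat vs fs \<in> carrier_mat ?N ?N" by (simp add: column_mat_def len)
  have "column_mat vs fs * X = 1\<^sub>m ?N"
  proof (rule eq_matI)
    fix i k assume "i < dim_row (1\<^sub>m ?N :: int mat)" "k < dim_col (1\<^sub>m ?N :: int mat)"
    then have ik: "i < ?N" "k < ?N" by auto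
    have "(column_mat vs fs * X) $$ (i, k) = (\<Sum>j<?N. x (vs ! k) j * (fs ! j) (vs ! i))"
      using ik len by (simp add: column_mat_def X_def scalar_prod_def atLeast0LessThan mult.commute)
    also have "\<dots> = of_bool (vs ! i = vs ! k)"
      using x[of "vs ! k" "vs ! i"] ik by simp
    also have "\<dots> = 1\<^sub>m ?N $$ (i, k)"
      using ik \<open>distinct vs\<close> by (simp add: nth_eq_iff_index_eq)
    finally show "(column_mat vs fs * X) $$ (i, k) = 1\<^sub>m ?N $$ (i, k)" .
  qed (use C X in auto)
  with right_inverse_imp_left_inverse_mat[OF C X] X show thesis
    by (intro that) auto
qed

text \<open>
  An entry \<open>(b, c, d)\<close> of the list says that the map sends the source vector \<open>b\<close>
  to \<open>d\<close> times the target vector \<open>c\<close>. This is how all base changes below are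
  recorded, so that no matrix larger than two by two has to be written down.
\<close>

lemma diagonal_form_from_bases:
  fixes K :: "'v \<Rightarrow> 'v \<Rightarrow> int" and xs :: "(('v \<Rightarrow> int) \<times> ('v \<Rightarrow> int) \<times> int) list"
  assumes vs: "distinct vs" and len: "length xs = length vs"
    and M: "M = mat (length vs) (length vs) (\<lambda>(i, j). K (vs ! i) (vs ! j))"
    and map: "\<And>b c d u. (b, c, d) \<in> set xs \<Longrightarrow> u \<in> set vs \<Longrightarrow> (\<Sum>v\<in>set vs. K u v * b v) = d * c u"
    and source: "\<And>v. v \<in> set vs \<Longrightarrow> (\<lambda>u. of_bool (u = v)) \<in> zspan ((\<lambda>(b, c, d). b) ` set xs)"
    and target: "\<And>v. v \<in> set vs \<Longrightarrow> (\<lambda>u. of_bool (u = v)) \<in> zspan ((\<lambda>(b, c, d). c) ` set xs)"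
  shows "\<exists>D. diagonal_form M D \<and> diag_mat D = map (\<lambda>(b, c, d). d) xs"
proof -
  let ?N = "length vs"
  define B where "B = column_mat vs (map (\<lambda>(b, c, d). b) xs)"
  define C where "C = column_mat vs (map (\<lambda>(b, c, d). c) xs)"
  define D where "D = mat ?N ?N (\<lambda>(i, j). if i = j then map (\<lambda>(b, c, d). d) xs ! i else 0)"
  have carr: "M \<in> carrier_mat ?N ?N" "B \<in> carrier_mat ?N ?N" "C \<in> carrier_mat ?N ?N" "D \<in> carrier_mat ?N ?N"
    by (simp_all add: M B_def C_def D_def column_mat_def len)
  obtain B' where B': "B' \<in> carrier_mat ?N ?N" "B * B' = 1\<^sub>m ?N" "B' * B = 1\<^sub>m ?N"
    using column_mat_invertible[of vs "map (\<lambda>(b, c, d). b) xs"] vs source len unfolding B_def by auto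
  obtain C' where C': "C' \<in> carrier_mat ?N ?N" "C * C' = 1\<^sub>m ?N" "C' * C = 1\<^sub>m ?N"
    using column_mat_invertible[of vs "map (\<lambda>(b, c, d). c) xs"] vs target len unfolding C_def by auto
  have "M * B = C * D"
  proof (rule eq_matI)
    fix i j assume "i < dim_row (C * D)" "j < dim_col (C * D)"
    then have ij: "i < ?N" "j < ?N" using carr by auto
    obtain b c d where j: "xs ! j = (b, c, d)" by (metis prod_cases3)
    have mem: "(b, c, d) \<in> set xs" using ij len j by (metis nth_mem)
    have "(M * B) $$ (i, j) = (\<Sum>k<?N. K (vs ! i) (vs ! k) * b (vs ! k))"
      using ij len j by (simp add: M B_def column_mat_def scalar_prod_def atLeast0LessThan)
    also have "\<dots> = (\<Sum>v\<in>set vs. K (vs ! i) v * b v)"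
      by (rule sum.reindex_bij_betw[OF bij_betw_nth[OF vs]]) auto
    also have "\<dots> = d * c (vs ! i)"
      using map[OF mem] ij by simp
    also have "\<dots> = (\<Sum>k<?N. C $$ (i, k) * D $$ (k, j))"
      using ij len j by (simp add: C_def D_def column_mat_def if_distrib cong: if_cong)
    also have "\<dots> = (C * D) $$ (i, j)"
      using ij carr by (simp add: scalar_prod_def atLeast0LessThan)
    finally show "(M * B) $$ (i, j) = (C * D) $$ (i, j)" .
  qed (use carr in auto)
  then have "C' * M * B = D"
    using carr B' C' by (metis assoc_mult_mat left_mult_one_mat)
  moreover have "invertible_mat B" "invertible_mat C'"
    using carr B' C' unfolding invertible_mat_def inverts_mat_def by auto
  moreover have "diagonal_mat D"
    by (simp add: diagonal_mat_def D_def)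
  ultimately have "diagonal_form M D"
    unfolding diagonal_form_def unimodular_mat_def using carr C'
    by (intro conjI exI[of _ C'] exI[of _ B]) auto
  moreover have "diag_mat D = map (\<lambda>(b, c, d). d) xs"
    by (rule nth_equalityI) (simp_all add: D_def diag_mat_def len)
  ultimately show ?thesis by blast
qed

lemma zspan_minusD: "- x \<in> zspan S \<Longrightarrow> x \<in> zspan S"
  using zmod.span_neg[of "- x" S] by simp

lemma sum_fun_apply: "(\<Sum>a\<in>B. g a) x = (\<Sum>a\<in>B. g a x)"
  for g :: "'b \<Rightarrow> 'c \<Rightarrow> int"
  by (induction B rule: infinite_finite_induct) simp_all

section \<open>Diagonal form of a two by two integer matrix\<close>

text \<open>
  Take for \<open>k\<close> the product of the primes that divide \<open>e\<close> but not \<open>c\<close>: a prime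
  factor of \<open>e\<close> divides exactly one of \<open>c\<close> and \<open>k * h\<close>, because
  it cannot divide all of \<open>h\<close>, \<open>c\<close> and \<open>e\<close>. Hence it does not divide
  their sum.
\<close>

lemma coprime_add_multiple_exists:
  fixes h c e :: int
  assumes "e \<noteq> 0" and cop: "gcd h (gcd c e) = 1"
  shows "\<exists>k. coprime (c + k * h) e"
proof
  define P where "P = {p \<in> prime_factors e. \<not> p dvd c}"
  define k where "k = \<Prod>P"
  have fin: "finite P" by (simp add: P_def)
  have dvd_k: "p dvd k \<longleftrightarrow> p \<in> P" if pr: "prime p" "p dvd e" for p
  proof
    assume "p dvd k"
    then obtain q where "q \<in> P" "p dvd q"
      unfolding k_def using pr fin by (auto simp: prime_dvd_prod_iff)
    then have "p = q"
      using pr by (auto simp: P_def intro: primes_dvd_imp_eq)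
    with \<open>q \<in> P\<close> show "p \<in> P" by simp
  qed (simp add: k_def fin dvd_prod_eqI)
  show "coprime (c + k * h) e"
  proof (rule ccontr)
    assume "\<not> coprime (c + k * h) e"
    then have "\<not> is_unit (gcd (c + k * h) e)"
      using is_unit_gcd by blast
    then obtain p where "prime p" "p dvd gcd (c + k * h) e"
      using prime_divisor_exists[of "gcd (c + k * h) e"] \<open>e \<noteq> 0\<close> by auto
    then have p: "prime p" "p dvd c + k * h" "p dvd e" by auto
    show False
    proof (cases "p dvd c")
      case True
      then have "\<not> p dvd k"
        using dvd_k p by (simp add: P_def)
      moreover have "p dvd k * h"
        using True p(2) by (simp add: dvd_add_right_iff)
      ultimately have "p dvd h"
        using p(1) by (simp add: prime_dvd_mult_iff)
      then have "p dvd gcd h (gcd c e)" using True p by simp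
      then show False using cop p(1) by (metis not_prime_unit)
    next
      case False
      then have "p dvd k"
        using p \<open>e \<noteq> 0\<close> by (subst dvd_k) (auto simp: P_def prime_factors_dvd)
      then have "p dvd c" using p(2) by (metis dvd_add_left_iff dvd_mult2)
      then show False using False by simp
    qed
  qed
qed

text \<open>
  After dividing by \<open>g\<close> and making the matrix triangular, a multiple of the first row can be
  added to the second so that the latter becomes primitive. A primitive row is part of a basis of
  the target, and clearing with it leaves the determinant as the other diagonal entry.
\<close>

lemma smith_form_rank_two:
  fixes L :: "'a::comm_ring_1 \<Rightarrow> 'a" and a b c e g D :: int
  assumes L_add: "\<And>x y. L (x + y) = L x + L y"
    and L_scale: "\<And>k x. L (of_int k * x) = of_int k * L x"
    and L1: "L s1 = of_int a * t1 + of_int b * t2"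
    and L2: "L s2 = of_int c * t1 + of_int e * t2"
    and g: "g = gcd (gcd a b) (gcd c e)" and det: "a * e - b * c = g * D"
    and nz: "a * e - b * c \<noteq> 0"
  shows "\<exists>s1' s2' t1' t2'. L s1' = of_int g * t1' \<and> L s2' = of_int D * t2'
    \<and> {s1, s2} \<subseteq> zspan {s1', s2'} \<and> {t1, t2} \<subseteq> zspan {t1', t2'}"
proof -
  have "g \<noteq> 0" using g nz by auto
  have "g dvd a" "g dvd b" "g dvd c" "g dvd e"
    unfolding g by (metis gcd_dvd1 gcd_dvd2 dvd_trans)+
  then obtain a0 b0 c0 e0 where abce: "a = g * a0" "b = g * b0" "c = g * c0" "e = g * e0"
    by (elim dvdE)
  let ?q = "gcd (gcd a0 b0) (gcd c0 e0)"
  have "?q dvd gcd a0 b0" "?q dvd gcd c0 e0" by (rule gcd_dvd1 gcd_dvd2)+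
  then have "g * ?q dvd gcd (gcd a b) (gcd c e)"
    unfolding abce by (intro gcd_greatest mult_dvd_mono dvd_refl) (simp_all only: gcd_greatest_iff)
  then have "g * ?q dvd g * 1" by (simp flip: g)
  then have g0: "gcd (gcd a0 b0) (gcd c0 e0) = 1" using \<open>g \<noteq> 0\<close> by simp
  have D: "D = g * (a0 * e0 - b0 * c0)"
  proof -
    have "g * D = g * (g * (a0 * e0 - b0 * c0))"
      using det by (simp add: abce algebra_simps)
    then show ?thesis using \<open>g \<noteq> 0\<close> by simp
  qed
  \<comment> \<open>A unimodular change of the target vectors clears the second entry of the first row.\<close>
  define h where "h = gcd a0 b0"
  obtain x y where xy: "x * a0 + y * b0 = h" using bezout_int unfolding h_def by blast
  have "h \<noteq> 0" using nz by (auto simp: h_def abce)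
  obtain a1 b1 where ab: "a0 = h * a1" "b0 = h * b1"
    unfolding h_def by (meson dvdE gcd_dvd1 gcd_dvd2)
  have "h * (a1 * x + b1 * y) = h * 1" using xy by (simp add: ab algebra_simps)
  then have xy1: "a1 * x + b1 * y = 1" using \<open>h \<noteq> 0\<close> by (simp only: mult_cancel_left) simp
  define c1 where "c1 = c0 * x + e0 * y"
  define e1 where "e1 = e0 * a1 - c0 * b1"
  have c0: "c0 = c1 * a1 - e1 * y" and e0: "e0 = c1 * b1 + e1 * x"
  proof -
    have "c1 * a1 - e1 * y = c0 * (a1 * x + b1 * y)" "c1 * b1 + e1 * x = e0 * (a1 * x + b1 * y)"
      by (simp_all add: c1_def e1_def algebra_simps)
    then show "c0 = c1 * a1 - e1 * y" "e0 = c1 * b1 + e1 * x" by (simp_all add: xy1)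
  qed
  have e1: "h * e1 = a0 * e0 - b0 * c0"
    by (simp add: e1_def ab algebra_simps)
  have "e1 \<noteq> 0"
  proof
    assume "e1 = 0"
    then have "a0 * e0 - b0 * c0 = 0" using e1 by simp
    then have "D = 0" by (simp add: D)
    then show False using det nz by simp
  qed
  have "gcd h (gcd c1 e1) dvd gcd (gcd a0 b0) (gcd c0 e0)"
  proof -
    let ?q = "gcd h (gcd c1 e1)"
    have "?q dvd h" "?q dvd c1" "?q dvd e1"
      by (metis gcd_dvd1 gcd_dvd2 dvd_trans)+
    then show ?thesis
      by (intro gcd_greatest) (auto simp: ab c0 e0)
  qed
  then have cop: "gcd h (gcd c1 e1) = 1" using g0 by simp
  \<comment> \<open>Adding a suitable multiple of the first row makes the second row primitive.\<close>
  obtain k where k: "coprime (c1 + k * h) e1"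
    using coprime_add_multiple_exists[OF \<open>e1 \<noteq> 0\<close> cop] by (rule exE)
  define c2 where "c2 = c1 + k * h"
  obtain u v where "u * c2 + v * e1 = gcd c2 e1" using bezout_int by blast
  then have uv: "u * c2 + v * e1 = 1" using k by (simp add: c2_def)
  define T1 where "T1 = of_int a1 * t1 + of_int b1 * t2"
  define T2 where "T2 = of_int x * t2 - of_int y * t1"
  have XY: "of_int a1 * of_int x + of_int b1 * of_int y = (1::'a)"
    using arg_cong[OF xy1, of "of_int :: int \<Rightarrow> 'a"] by simp
  have t1: "t1 = of_int x * T1 - of_int b1 * T2" and t2: "t2 = of_int y * T1 + of_int a1 * T2"
  proof -
    have "of_int x * T1 - of_int b1 * T2 = (of_int a1 * of_int x + of_int b1 * of_int y) * t1"
      "of_int y * T1 + of_int a1 * T2 = (of_int a1 * of_int x + of_int b1 * of_int y) * t2"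
      by (simp_all add: T1_def T2_def algebra_simps)
    then show "t1 = of_int x * T1 - of_int b1 * T2" "t2 = of_int y * T1 + of_int a1 * T2"
      by (simp_all add: XY)
  qed
  define U1 where "U1 = of_int c2 * T1 + of_int e1 * T2"
  define U2 where "U2 = of_int v * T1 - of_int u * T2"
  have UV: "of_int u * of_int c2 + of_int v * of_int e1 = (1::'a)"
    using arg_cong[OF uv, of "of_int :: int \<Rightarrow> 'a"] by simp
  have T1: "T1 = of_int u * U1 + of_int e1 * U2" and T2: "T2 = of_int v * U1 - of_int c2 * U2"
  proof -
    have "of_int u * U1 + of_int e1 * U2 = (of_int u * of_int c2 + of_int v * of_int e1) * T1"
      "of_int v * U1 - of_int c2 * U2 = (of_int u * of_int c2 + of_int v * of_int e1) * T2"
      by (simp_all add: U1_def U2_def algebra_simps)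
    then show "T1 = of_int u * U1 + of_int e1 * U2" "T2 = of_int v * U1 - of_int c2 * U2"
      by (simp_all add: UV)
  qed
  define S2 where "S2 = s2 + of_int k * s1"
  define S1 where "S1 = s1 - of_int (h * u) * S2"
  have L_diff: "L (p - q) = L p - L q" for p q
    using L_add[of p "of_int (-1) * q"] L_scale[of "-1" q] by simp
  have Ls1: "L s1 = of_int g * of_int h * T1"
    by (simp only: L1 abce ab T1_def of_int_mult distrib_left mult.assoc)
  have "L s2 = of_int c * (of_int x * T1 - of_int b1 * T2) + of_int e * (of_int y * T1 + of_int a1 * T2)"
    by (simp only: L2 t1[symmetric] t2[symmetric])
  then have Ls2: "L s2 = of_int g * (of_int c1 * T1 + of_int e1 * T2)"
    by (simp add: abce c1_def e1_def algebra_simps)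
  then have LS2: "L S2 = of_int g * U1"
    unfolding S2_def L_add L_scale Ls1 Ls2 U1_def c2_def by (simp add: algebra_simps)
  have "L S1 = of_int g * of_int h * (of_int u * U1 + of_int e1 * U2) - of_int (h * u) * (of_int g * U1)"
    by (simp only: S1_def L_diff L_scale Ls1 LS2 T1[symmetric])
  then have "L S1 = of_int D * U2"
    by (simp add: D e1[symmetric] algebra_simps)
  moreover have "{s1, s2} \<subseteq> zspan {S2, S1}"
  proof -
    have "S1 + of_int (h * u) * S2 \<in> zspan {S2, S1}"
      by (intro zmod.span_add zspan_of_int_mult zmod.span_base) auto
    then have s1: "s1 \<in> zspan {S2, S1}" by (simp add: S1_def)
    have "S2 - of_int k * s1 \<in> zspan {S2, S1}"
      by (intro zmod.span_diff zspan_of_int_mult s1) (auto intro: zmod.span_base)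
    then have "s2 \<in> zspan {S2, S1}" by (simp add: S2_def)
    with s1 show ?thesis by simp
  qed
  moreover have "{t1, t2} \<subseteq> zspan {U1, U2}"
  proof -
    have "of_int u * U1 + of_int e1 * U2 \<in> zspan {U1, U2}" "of_int v * U1 - of_int c2 * U2 \<in> zspan {U1, U2}"
      by (intro zmod.span_add zmod.span_diff zspan_of_int_mult zmod.span_base; simp)+
    then have T: "T1 \<in> zspan {U1, U2}" "T2 \<in> zspan {U1, U2}"
      using T1 T2 by simp_all
    have "of_int x * T1 - of_int b1 * T2 \<in> zspan {U1, U2}" "of_int y * T1 + of_int a1 * T2 \<in> zspan {U1, U2}"
      by (intro zmod.span_add zmod.span_diff zspan_of_int_mult T)+
    then show ?thesis using t1 t2 by simp
  qed
  ultimately show ?thesis using LS2 by blast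
qed

section \<open>Eigenvalues and greatest common divisors\<close>

lemma two_choose_two: "2 * int (k choose 2) = int k * (int k - 1)"
proof (induction k)
  case (Suc k)
  then show ?case by (simp add: numeral_2_eq_2 algebra_simps)
qed simp

lemma six_choose_three: "6 * int (k choose 3) = int k * (int k - 1) * (int k - 2)"
proof (induction k)
  case (Suc k)
  with two_choose_two[of k] show ?case
    by (simp add: numeral_3_eq_3 numeral_2_eq_2 algebra_simps)
qed simp

lemma dvd_lincomb: 
  fixes g :: int
  assumes "g dvd a" "g dvd b" "z = x * a + y * b"
  shows "g dvd z"
  using assms by simp

lemma mset_map_concat_const:
  assumes "\<And>a. a \<in> set l \<Longrightarrow> mset (map g (f a)) = M"
  shows "mset (map g (concat (map f l))) = repeat_mset (length l) M"
  using assms by (induction l) simp_all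

text \<open>
  The polynomial identities are shortest in terms of \<open>m = n - 5\<close>, a common factor of
  \<open>theta1\<close> and \<open>theta2\<close>. The eigenvalues of the Laplacian are 0 and the negatives of the
  three numbers \<open>theta1\<close>, \<open>theta2\<close>, \<open>theta3\<close>.
\<close>

locale kneser3 =
  fixes n :: nat
  assumes n7: "7 \<le> n"
begin

definition deg :: int where "deg = int ((n - 3) choose 3)"
definition c2 :: int where "c2 = int ((n - 4) choose 2)"
definition m :: int where "m = int n - 5"
definition theta3 :: int where "theta3 = deg + 1"
definition theta2 :: int where "theta2 = deg - m"
definition theta1 :: int where "theta1 = deg + c2"

lemma n_eq: "int n = m + 5" by (simp add: m_def)

lemma m_ge: "m \<ge> 2" using n7 by (simp add: m_def)

lemma deg_eq: "6 * deg = m * (m + 1) * (m + 2)"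
  using six_choose_three[of "n - 3"] n7 by (simp add: deg_def m_def of_nat_diff algebra_simps)

lemma c2_eq: "2 * c2 = m * (m + 1)"
  using two_choose_two[of "n - 4"] n7 by (simp add: c2_def m_def of_nat_diff algebra_simps)

lemma theta3_eq: "6 * theta3 = (m^2 + 2) * (m + 3)"
  using deg_eq by (simp add: theta3_def algebra_simps power2_eq_square)

lemma theta2_eq: "6 * theta2 = m * (m + 4) * (m - 1)"
  using deg_eq by (simp add: theta2_def algebra_simps)

lemma theta1_eq: "6 * theta1 = m * (m + 1) * (m + 5)"
  using deg_eq c2_eq by (simp add: theta1_def algebra_simps)

lemma X_eq: "Kneser3_X (int n) = gcd (2 * theta1) (gcd (theta2 + 2 * m) (theta3 * theta1))"
proof -
  have "3 * (2 * theta1) = (int n - 4) * (int n - 5) * int n"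
    using theta1_eq by (simp add: n_eq algebra_simps)
  then have 1: "(int n - 4) * (int n - 5) * int n div 3 = 2 * theta1"
    by (metis nonzero_mult_div_cancel_left zero_neq_numeral)
  have "6 * (theta2 + 2 * m) = ((int n)^2 - 7 * int n + 18) * (int n - 5)"
    using theta2_eq by (simp add: n_eq algebra_simps power2_eq_square)
  then have 2: "((int n)^2 - 7 * int n + 18) * (int n - 5) div 6 = theta2 + 2 * m"
    by (metis nonzero_mult_div_cancel_left zero_neq_numeral)
  have "36 * (theta3 * theta1) = (6 * theta3) * (6 * theta1)" by simp
  also have "\<dots> = ((int n)^2 - 10 * int n + 27) * (int n - 2) * (int n - 4) * (int n - 5) * int n"
    unfolding theta3_eq theta1_eq by (simp add: n_eq algebra_simps power2_eq_square)
  finally have 3: "((int n)^2 - 10 * int n + 27) * (int n - 2) * (int n - 4) * (int n - 5) * int n div 36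
    = theta3 * theta1"
    by (metis nonzero_mult_div_cancel_left zero_neq_numeral)
  show ?thesis unfolding Kneser3_X_def 1 2 3 ..
qed

lemma Y_eq: "Kneser3_Y (int n) = gcd m (gcd (3 * c2) (2 * theta2 + m * (m + 4)))"
proof -
  have "2 * (3 * c2) = 3 * (int n - 4) * (int n - 5)"
    using c2_eq by (simp add: n_eq algebra_simps)
  then have 1: "3 * (int n - 4) * (int n - 5) div 2 = 3 * c2"
    by (metis nonzero_mult_div_cancel_left zero_neq_numeral)
  have "3 * (2 * theta2 + m * (m + 4)) = (int n - 1) * (int n - 3) * (int n - 5)"
    using theta2_eq by (simp add: n_eq algebra_simps power2_eq_square)
  then have 2: "(int n - 1) * (int n - 3) * (int n - 5) div 3 = 2 * theta2 + m * (m + 4)"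
    by (metis nonzero_mult_div_cancel_left zero_neq_numeral)
  show ?thesis unfolding Kneser3_Y_def 1 2 by (simp add: m_def)
qed

text \<open>
  One entry of the two by two matrix of the rank 3 sublattices, \<open>m * theta3\<close>, does not occur
  in the formula for \<open>X\<close>; it is a multiple of \<open>X\<close> all the same. The hypotheses give
  that \<open>g\<close> divides \<open>m * (m - 1)\<close> and \<open>12 * m\<close>, so only the primes 2 and 3 matter.
  They are separated by proving divisibility of the multiples by 9 and by 8.
\<close>

lemma X_dvd:
  assumes A: "g dvd 2 * theta1" and B: "g dvd theta2 + 2 * m"
  shows "g dvd m * theta3"
proof -
  define b where "b = theta2 + 2 * m"
  note B = B[folded b_def]
  have b: "6 * b = m * (m + 4) * (m - 1) + 12 * m" using theta2_eq by (simp add: b_def)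
  have I: "g dvd m * (m - 1)"
    by (rule dvd_lincomb[OF A B, of _ 1 "-2"])
      (use theta1_eq b in \<open>simp add: algebra_simps\<close>)
  have J: "g dvd 12 * m"
    by (rule dvd_lincomb[OF I B, of _ "- (m + 4)" 6])
      (use b in \<open>simp add: algebra_simps\<close>)
  have mult: "g dvd k * (m * theta3)" if "g dvd r * m" "r dvd k" for r k
  proof -
    have "r * m dvd k * (m * theta3)"
      using mult_dvd_mono[OF that(2), of m "m * theta3"] by simp
    with that(1) show ?thesis by (rule dvd_trans)
  qed
  have nine: "g dvd 9 * (m * theta3)"
  proof -
    consider (e) k where "m = 2 * k" | (a) k where "m = 4 * k + 3"
      | (c) l where "m = 4 * (2 * l) + 1" | (f) l where "m = 4 * (2 * l + 1) + 1"
    proof -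
      have "m = 2 * (m div 2) \<or> m = 4 * (m div 4) + 3 \<or> m = 4 * (2 * (m div 8)) + 1
        \<or> m = 4 * (2 * (m div 8) + 1) + 1"
        by presburger
      then show ?thesis using that by metis
    qed
    then show ?thesis
    proof cases
      case e
      have 6: "g dvd 6 * m"
        by (rule dvd_lincomb[OF I B, of _ "- (k + 2)" 3]) (use b e in \<open>simp add: algebra_simps\<close>)
      have "g dvd 3 * m"
        by (rule dvd_lincomb[OF I 6, of _ "- 3" k]) (use e in \<open>simp add: algebra_simps\<close>)
      then show ?thesis by (rule mult) simp
    next
      case a
      have 6: "g dvd 6 * m"
        by (rule dvd_lincomb[OF I J, of _ 3 "- k"]) (use a in \<open>simp add: algebra_simps\<close>)
      have "g dvd 9 * m"
        by (rule dvd_lincomb[OF B 6, of _ 9 "- (4 * k^2 + 9 * k + 5)"])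
          (use a b in \<open>simp add: algebra_simps power2_eq_square\<close>)
      then show ?thesis by (rule mult) simp
    next
      case c
      have 6: "g dvd 6 * m"
        by (rule dvd_lincomb[OF B J, of _ 9 "- (l * (8 * l + 5) + 1)"])
          (use c b in \<open>simp add: algebra_simps\<close>)
      have eq: "3 * theta3 = 2 * ((m^2 + 2) * (2 * l + 1))"
        using theta3_eq c by (simp add: algebra_simps power2_eq_square)
      have "9 * (m * theta3) = 3 * m * (3 * theta3)" by simp
      also have "\<dots> = 6 * m * ((m^2 + 2) * (2 * l + 1))" unfolding eq by simp
      finally have "9 * (m * theta3) = 6 * m * ((m^2 + 2) * (2 * l + 1))" .
      with 6 show ?thesis by (simp only: dvd_mult2)
    next
      case f
      have eq: "3 * theta3 = 4 * ((m^2 + 2) * (l + 1))"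
        using theta3_eq f by (simp add: algebra_simps power2_eq_square)
      have "9 * (m * theta3) = 3 * m * (3 * theta3)" by simp
      also have "\<dots> = 12 * m * ((m^2 + 2) * (l + 1))" unfolding eq by simp
      finally have "9 * (m * theta3) = 12 * m * ((m^2 + 2) * (l + 1))" .
      with J show ?thesis by (simp only: dvd_mult2)
    qed
  qed
  have eight: "g dvd 8 * (m * theta3)"
  proof -
    consider (e) k where "m = 3 * k + 2" | (a) k where "m = 3 * k"
      | (c) j where "m = 3 * (3 * j) + 1" | (f) j where "m = 3 * (3 * j + 1) + 1"
      | (h) j where "m = 3 * (3 * j + 2) + 1"
    proof -
      have "m = 3 * (m div 3) + 2 \<or> m = 3 * (m div 3) \<or> m = 3 * (3 * (m div 9)) + 1
        \<or> m = 3 * (3 * (m div 9) + 1) + 1 \<or> m = 3 * (3 * (m div 9) + 2) + 1"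
        by presburger
      then show ?thesis using that by metis
    qed
    then show ?thesis
    proof cases
      case e
      have "g dvd 4 * m"
        by (rule dvd_lincomb[OF I B, of _ "- (k + 2)" 2]) (use b e in \<open>simp add: algebra_simps\<close>)
      then show ?thesis by (rule mult) simp
    next
      case a
      have "g dvd 4 * m"
        by (rule dvd_lincomb[OF I J, of _ "- 4" k]) (use a in \<open>simp add: algebra_simps\<close>)
      then show ?thesis by (rule mult) simp
    next
      case c
      have "g dvd 4 * m"
        by (rule dvd_lincomb[OF B J, of _ 8 "- (9 * j^2 + 5 * j + 1)"])
          (use c b in \<open>simp add: algebra_simps power2_eq_square\<close>)
      then show ?thesis by (rule mult) simp
    next
      case f
      have eq: "2 * theta3 = 3 * ((9 * j^2 + 8 * j + 2) * (m + 3))"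
        using theta3_eq f by (simp add: algebra_simps power2_eq_square)
      have "8 * (m * theta3) = 4 * m * (2 * theta3)" by simp
      also have "\<dots> = 12 * m * ((9 * j^2 + 8 * j + 2) * (m + 3))" unfolding eq by simp
      finally have "8 * (m * theta3) = 12 * m * ((9 * j^2 + 8 * j + 2) * (m + 3))" .
      with J show ?thesis by (simp only: dvd_mult2)
    next
      case h
      have "g dvd 8 * m"
        by (rule dvd_lincomb[OF B J, of _ 8 "- (9 * j^2 + 17 * j + 8)"])
          (use h b in \<open>simp add: algebra_simps power2_eq_square\<close>)
      then show ?thesis by (rule mult) simp
    qed
  qed
  show ?thesis
    by (rule dvd_lincomb[OF nine eight, of _ 1 "- 1"]) simp
qed

text \<open>
  The right-hand side lists the entries of the two by two matrix of a rank 3 sublattice.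
\<close>

lemma X_gcd:
  "Kneser3_X (int n) = gcd (gcd (m * theta3) (- (theta2 + 2 * m))) (gcd (theta1 * theta3) (- 2 * theta1))"
proof -
  let ?X = "Kneser3_X (int n)"
  have dv: "?X dvd 2 * theta1" "?X dvd theta2 + 2 * m" "?X dvd theta3 * theta1"
    unfolding X_eq by (metis gcd_dvd1 gcd_dvd2 dvd_trans)+
  have "?X dvd gcd (gcd (m * theta3) (- (theta2 + 2 * m))) (gcd (theta1 * theta3) (- 2 * theta1))"
  proof (intro gcd_greatest)
    show "?X dvd m * theta3" by (rule X_dvd[OF dv(1,2)])
    show "?X dvd - (theta2 + 2 * m)" using dv(2) by (simp only: dvd_minus_iff)
    show "?X dvd theta1 * theta3" using dv(3) by (simp only: mult.commute)
    show "?X dvd - 2 * theta1" using dv(1) by simp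
  qed
  moreover have "gcd (gcd (m * theta3) (- (theta2 + 2 * m))) (gcd (theta1 * theta3) (- 2 * theta1)) dvd ?X"
  proof -
    let ?g = "gcd (gcd (m * theta3) (- (theta2 + 2 * m))) (gcd (theta1 * theta3) (- 2 * theta1))"
    have "?g dvd gcd (m * theta3) (- (theta2 + 2 * m))" "?g dvd gcd (theta1 * theta3) (- 2 * theta1)"
      by (rule gcd_dvd1 gcd_dvd2)+
    then have g: "?g dvd - (theta2 + 2 * m)" "?g dvd theta1 * theta3" "?g dvd - 2 * theta1"
      by (simp_all only: gcd_greatest_iff)
    have "?g dvd theta2 + 2 * m"
      by (rule dvd_lincomb[OF g(1,1), of _ "- 1" 0]) simp
    moreover have "?g dvd 2 * theta1"
      by (rule dvd_lincomb[OF g(3,3), of _ "- 1" 0]) simp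
    ultimately show ?thesis
      unfolding X_eq using g(2) by (intro gcd_greatest) (simp_all only: mult.commute)
  qed
  moreover have "0 \<le> ?X" unfolding X_eq by (rule gcd_ge_0_int)
  ultimately show ?thesis
    by (intro zdvd_antisym_nonneg gcd_ge_0_int)
qed

text \<open>
  The right-hand side lists the entries of the two by two matrix of the rank 4 sublattice. To see
  that \<open>Y\<close> divides \<open>theta1\<close> and \<open>theta2\<close> it is enough that it divides coprime
  multiples of them: the doubles, and 9 times and 3 times, respectively.
\<close>

lemma Y_gcd:
  "Kneser3_Y (int n) = gcd (gcd (- (theta2 + 3 * m)) m) (gcd (- 3 * c2) (3 * c2 - theta1))"
proof -
  let ?Y = "Kneser3_Y (int n)"
  let ?g = "gcd (gcd (- (theta2 + 3 * m)) m) (gcd (- 3 * c2) (3 * c2 - theta1))"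
  have Y: "?Y dvd m" "?Y dvd 3 * c2" "?Y dvd 2 * theta2 + m * (m + 4)"
    unfolding Y_eq by (metis gcd_dvd1 gcd_dvd2 dvd_trans)+
  obtain k where k: "(m + 4) * (m - 1) = 2 * k"
  proof -
    have "even ((m + 4) * (m - 1))" by simp
    then show ?thesis using that by (elim dvdE)
  qed
  have "6 * theta2 = m * (2 * k)" using theta2_eq by (simp only: k[symmetric] mult.assoc)
  then have "3 * theta2 = k * m" by simp
  then have theta2: "?Y dvd theta2"
    using dvd_lincomb[OF Y(1,3), of theta2 "k + m + 4" "- 1"] by (simp add: algebra_simps)
  have "(m + 5) * (3 * (2 * c2)) = 3 * (6 * theta1)"
    unfolding theta1_eq c2_eq by (simp add: algebra_simps)
  then have t1: "9 * theta1 = (m + 5) * (3 * c2)" by (simp add: algebra_simps)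
  have t2: "2 * theta1 = 2 * theta2 + m * (m + 4) - m"
    using theta1_eq theta2_eq by (simp add: algebra_simps)
  have "?Y dvd 2 * theta1"
    unfolding t2 using Y(1,3) by (rule dvd_diff[rotated])
  then have theta1: "?Y dvd theta1"
    using dvd_lincomb[of ?Y "2 * theta1" "3 * c2" theta1 "- 4" "m + 5"] Y(2) t1 by (simp add: algebra_simps)
  have "?g dvd gcd (- (theta2 + 3 * m)) m" "?g dvd gcd (- 3 * c2) (3 * c2 - theta1)"
    by (rule gcd_dvd1 gcd_dvd2)+
  then have g: "?g dvd - (theta2 + 3 * m)" "?g dvd m" "?g dvd - 3 * c2"
    by (simp_all only: gcd_greatest_iff)
  have "?g dvd theta2"
    by (rule dvd_lincomb[OF g(1,2), of _ "- 1" "- 3"]) simp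
  moreover have "?g dvd 3 * c2"
    by (rule dvd_lincomb[OF g(3,3), of _ "- 1" 0]) simp
  moreover have "?g dvd 2 * theta2 + m * (m + 4)"
    by (rule dvd_lincomb[OF \<open>?g dvd theta2\<close> g(2), of _ 2 "m + 4"]) (simp add: algebra_simps)
  ultimately have "?g dvd ?Y"
    unfolding Y_eq using g(2) by (intro gcd_greatest)
  moreover have "?Y dvd ?g"
    using Y theta1 theta2 by (intro gcd_greatest) (simp_all add: dvd_diff)
  moreover have "0 \<le> ?Y" unfolding Y_eq by (rule gcd_ge_0_int)
  ultimately show ?thesis
    by (intro zdvd_antisym_nonneg gcd_ge_0_int)
qed

section \<open>The Laplacian on indicator functions\<close>

definition V :: "nat set set" where "V = Gamma_vertices n 3"

text \<open>
  All functions vanish outside \<open>V\<close>, so that identities between them hold as equations of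
  functions.
\<close>

definition w :: "nat set \<Rightarrow> nat set \<Rightarrow> int" where
  "w R = (\<lambda>S. of_bool (S \<in> V \<and> R \<subseteq> S))"

definition Lap :: "(nat set \<Rightarrow> int) \<Rightarrow> nat set \<Rightarrow> int" where
  "Lap f = (\<lambda>S. if S \<in> V then (\<Sum>T\<in>V. of_bool (S \<inter> T = {}) * f T) - deg * f S else 0)"

lemma V_iff: "S \<in> V \<longleftrightarrow> S \<subseteq> {1..n} \<and> card S = 3"
  by (simp add: V_def Gamma_vertices_def)

lemma finite_V: "finite V"
  by (rule finite_subset[of _ "Pow {1..n}"]) (use V_iff in blast, simp)

lemma Lap_add: "Lap (f + g) = Lap f + Lap g"
  by (rule ext) (simp add: Lap_def sum.distrib algebra_simps)

lemma Lap_scale: "Lap (of_int k * f) = of_int k * Lap f"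
  by (rule ext) (simp add: Lap_def sum_distrib_left algebra_simps)

lemma Lap_minus: "Lap (- f) = - Lap f"
  using Lap_scale[of "-1" f] by simp

lemma Lap_diff: "Lap (f - g) = Lap f - Lap g"
  using Lap_add[of f "- g"] by (simp add: Lap_minus)

lemma Lap_numeral: "Lap (numeral k * f) = numeral k * Lap f"
  using Lap_scale[of "numeral k" f] by simp

lemmas Lap_linear = Lap_add Lap_diff Lap_numeral Lap_scale Lap_minus

definition disj :: "nat set \<Rightarrow> nat set \<Rightarrow> int" where
  "disj R = (\<lambda>S. of_bool (S \<in> V \<and> R \<inter> S = {}))"

lemma card_disjoint_extensions:
  assumes R: "R \<subseteq> {1..n}" "card R \<le> 3" and S: "S \<in> V" and disj: "R \<inter> S = {}"
  shows "card {T \<in> V. S \<inter> T = {} \<and> R \<subseteq> T} = (n - 3 - card R) choose (3 - card R)"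
proof -
  let ?W = "{1..n} - (S \<union> R)"
  have fin: "finite S" "finite R" using R S by (auto simp: V_iff intro: finite_subset)
  have card_W: "card ?W = n - 3 - card R"
    using R S disj fin by (simp add: V_iff card_Diff_subset card_Un_disjoint Int_commute)
  have "{T \<in> V. S \<inter> T = {} \<and> R \<subseteq> T} = (\<union>) R ` {T'. T' \<subseteq> ?W \<and> card T' = 3 - card R}"
  proof (intro equalityI subsetI)
    fix T assume "T \<in> {T \<in> V. S \<inter> T = {} \<and> R \<subseteq> T}"
    then have T: "T \<subseteq> {1..n}" "card T = 3" "S \<inter> T = {}" "R \<subseteq> T" by (auto simp: V_iff)
    then show "T \<in> (\<union>) R ` {T'. T' \<subseteq> ?W \<and> card T' = 3 - card R}"
      using fin by (intro image_eqI[of _ _ "T - R"]) (auto simp: card_Diff_subset)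
  next
    fix T assume "T \<in> (\<union>) R ` {T'. T' \<subseteq> ?W \<and> card T' = 3 - card R}"
    then obtain T' where T': "T = R \<union> T'" "T' \<subseteq> ?W" "card T' = 3 - card R" by auto
    have "finite T'" using T'(2) finite_subset by fastforce
    then have "card T = 3"
      unfolding T'(1) using T' R(2) fin by (subst card_Un_disjoint) auto
    then show "T \<in> {T \<in> V. S \<inter> T = {} \<and> R \<subseteq> T}" using T' R disj by (auto simp: V_iff)
  qed
  moreover have "inj_on ((\<union>) R) {T'. T' \<subseteq> ?W \<and> card T' = 3 - card R}"
    by (rule inj_onI) blast
  ultimately show ?thesis
    by (simp only: card_image n_subsets card_W finite_Diff finite_atLeastAtMost)
qed

text \<open>
  Summing over the triples disjoint from \<open>S\<close> counts the extensions of \<open>R\<close> that avoid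
  \<open>S\<close>, and their number depends only on the size of \<open>R\<close>.
\<close>

lemma Lap_w:
  assumes "R \<subseteq> {1..n}" "card R \<le> 3"
  shows "Lap (w R) = of_int (int ((n - 3 - card R) choose (3 - card R))) * disj R - of_int deg * w R"
proof
  fix S
  show "Lap (w R) S = (of_int (int ((n - 3 - card R) choose (3 - card R))) * disj R - of_int deg * w R) S"
  proof (cases "S \<in> V")
    case True
    have "(\<Sum>T\<in>V. of_bool (S \<inter> T = {}) * w R T) = (\<Sum>T\<in>V. of_bool (S \<inter> T = {} \<and> R \<subseteq> T))"
      by (intro sum.cong) (auto simp: w_def)
    also have "\<dots> = int (card {T \<in> V. S \<inter> T = {} \<and> R \<subseteq> T})"
      using finite_V by (simp add: sum_of_bool_eq Int_def)
    also have "\<dots> = int ((n - 3 - card R) choose (3 - card R)) * of_bool (R \<inter> S = {})"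
    proof (cases "R \<inter> S = {}")
      case False
      then have "{T \<in> V. S \<inter> T = {} \<and> R \<subseteq> T} = {}" by blast
      then show ?thesis using False by (simp only: card.empty) simp
    qed (use card_disjoint_extensions[OF assms True] in simp)
    finally show ?thesis using True by (simp add: Lap_def disj_def)
  qed (simp add: Lap_def disj_def w_def)
qed

lemma disj_0: "disj {} = w {}"
  by (rule ext) (simp add: disj_def w_def)

lemma disj_1: "disj {i} = w {} - w {i}"
  by (rule ext) (simp add: disj_def w_def)

lemma disj_2: "disj {i, j} = w {} - w {i} - w {j} + w {i, j}"
  by (rule ext) (auto simp: disj_def w_def of_bool_def)

lemma disj_3: "disj {i, j, k} = w {} - w {i} - w {j} - w {k} + w {i, j} + w {i, k} + w {j, k} - w {i, j, k}"
  by (rule ext) (auto simp: disj_def w_def of_bool_def)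

lemma Lap_w_empty: "Lap (w {}) = 0"
  using Lap_w[of "{}"] by (simp add: disj_0 deg_def)

lemma Lap_w_one:
  assumes "i \<in> {1..n}"
  shows "Lap (w {i}) = of_int c2 * w {} - of_int theta1 * w {i}"
proof -
  have "int ((n - 3 - card {i}) choose (3 - card {i})) = c2"
    by (simp add: c2_def eval_nat_numeral)
  then show ?thesis
    using Lap_w[of "{i}"] assms by (simp only: disj_1 theta1_def) (simp add: algebra_simps)
qed

lemma Lap_w_two:
  assumes "i \<in> {1..n}" "j \<in> {1..n}" "i \<noteq> j"
  shows "Lap (w {i, j}) = of_int m * (w {} - w {i} - w {j}) - of_int theta2 * w {i, j}"
proof -
  have "int (n - 5) = m" using n7 by (simp add: m_def)
  then show ?thesis
    using Lap_w[of "{i, j}"] assms by (simp add: disj_2 theta2_def algebra_simps of_nat_diff)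
qed

lemma Lap_w_three:
  assumes "i \<in> {1..n}" "j \<in> {1..n}" "k \<in> {1..n}" "i \<noteq> j" "i \<noteq> k" "j \<noteq> k"
  shows "Lap (w {i, j, k}) = w {} - w {i} - w {j} - w {k} + w {i, j} + w {i, k} + w {j, k}
    - of_int theta3 * w {i, j, k}"
  using Lap_w[of "{i, j, k}"] assms by (simp add: disj_3 theta3_def algebra_simps)

text \<open>
  The substitutes for the monomials with a power of \<open>x\<^sub>1\<close>. As a signed graph
  \<open>x1_sq\<close> has degree 2 at the point 1 and degree 0 elsewhere. Multiplying it by
  \<open>x\<^sub>j\<close> gives \<open>x\<^sub>1\<^sup>2 x\<^sub>j\<close> when \<open>j \<ge> 4\<close>. For
  \<open>j = 2\<close> the required derivative \<open>3 x\<^sub>1 x\<^sub>2 + x\<^sub>1 x\<^sub>3 - x\<^sub>2 x\<^sub>3\<close> is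
  that of \<open>x\<^sub>1 x\<^sub>2 x\<^sub>3 + (x\<^sub>1 - x\<^sub>3) (x\<^sub>2 x\<^sub>4 + x\<^sub>2 x\<^sub>6 - x\<^sub>4 x\<^sub>6)\<close>, and for
  \<open>j = 3\<close> there is a similar expression. The auxiliary points are 4, 6 in one case and 4, 5 in the
  other; with the same pair in both cases the vectors below would fail to be a basis already for
  \<open>n = 7\<close>. The cube is chosen such that \<open>x\<^sub>1 (x\<^sub>2 - x\<^sub>1) (x\<^sub>3 - x\<^sub>1)\<close>
  becomes 0, in accordance with \<open>(x\<^sub>2 - x\<^sub>1) (x\<^sub>3 - x\<^sub>1) = 0\<close>.
\<close>

definition x1_sq :: "nat set \<Rightarrow> int" where
  "x1_sq = w {1, 2} + w {1, 3} - w {2, 3}"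

definition x1_sq_times :: "nat \<Rightarrow> nat set \<Rightarrow> int" where
  "x1_sq_times j = (if j = 2 then w {1, 2, 3} + w {1, 2, 4} + w {1, 2, 6} - w {1, 4, 6} - w {2, 3, 4} - w {2, 3, 6} + w {3, 4, 6}
      else if j = 3 then w {1, 2, 3} + w {1, 3, 4} + w {1, 3, 5} - w {1, 4, 5} - w {2, 3, 4} - w {2, 3, 5} + w {2, 4, 5}
      else w {1, 2, j} + w {1, 3, j} - w {2, 3, j})"

definition x1_cube :: "nat set \<Rightarrow> int" where
  "x1_cube = x1_sq_times 2 + x1_sq_times 3 - w {1, 2, 3}"

lemma Lap_x1_sq: "Lap x1_sq = of_int m * (w {} - 2 * w {1}) - of_int theta2 * x1_sq"
  using n7 by (simp add: x1_sq_def Lap_linear Lap_w_two algebra_simps)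

text \<open>
  Apart from the multiple of \<open>theta3\<close>, the right-hand side is what the formula for
  \<open>Lap (w {i, j, k})\<close> gives if the indices are formally \<open>1, 1, j\<close> and
  \<open>w {1, 1}\<close> is read as \<open>x1_sq\<close>. The same holds for the cube with indices
  \<open>1, 1, 1\<close>.
\<close>

lemma Lap_x1_sq_times:
  assumes "j \<in> {2..n}"
  shows "Lap (x1_sq_times j) = 2 * w {1, j} + x1_sq - 2 * w {1} - w {j} + w {} - of_int theta3 * x1_sq_times j"
proof -
  consider "j = 2" | "j = 3" | "j \<ge> 4" using assms by force
  then show ?thesis
  proof cases
    case 1
    then show ?thesis using n7 by (simp add: x1_sq_times_def x1_sq_def Lap_linear Lap_w_three algebra_simps)
  next
    case 2
    then show ?thesis using n7 by (simp add: x1_sq_times_def x1_sq_def Lap_linear Lap_w_three algebra_simps)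
  next
    case 3
    then show ?thesis using n7 assms by (simp add: x1_sq_times_def x1_sq_def Lap_linear Lap_w_three algebra_simps)
  qed
qed

lemma Lap_x1_cube: "Lap x1_cube = 3 * x1_sq - 3 * w {1} + w {} - of_int theta3 * x1_cube"
  using n7 by (simp add: x1_cube_def Lap_linear Lap_x1_sq_times Lap_w_three algebra_simps x1_sq_def)

text \<open>
  The expansions of \<open>(x\<^sub>i - x\<^sub>1) (x\<^sub>j - x\<^sub>1) (x\<^sub>k - x\<^sub>1)\<close>, of
  \<open>x\<^sub>1 (x\<^sub>i - x\<^sub>1) (x\<^sub>j - x\<^sub>1)\<close> and of
  \<open>up ((x\<^sub>i - x\<^sub>1) (x\<^sub>j - x\<^sub>1))\<close>, where \<open>S = {i, j, k}\<close> and
  \<open>p = {i, j}\<close>.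
\<close>

definition cubic :: "nat set \<Rightarrow> nat set \<Rightarrow> int" where
  "cubic S = w S - (\<Sum>i\<in>S. w (insert 1 (S - {i}))) + (\<Sum>i\<in>S. x1_sq_times i) - x1_cube"

definition x1_times :: "nat set \<Rightarrow> nat set \<Rightarrow> int" where
  "x1_times p = w (insert 1 p) - (\<Sum>i\<in>p. x1_sq_times i) + x1_cube"

definition quadratic :: "nat set \<Rightarrow> nat set \<Rightarrow> int" where
  "quadratic p = w p - (\<Sum>i\<in>p. w {1, i}) + x1_sq"

lemma Lap_cubic:
  assumes "S \<subseteq> {2..n}" "card S = 3"
  shows "Lap (cubic S) = - of_int theta3 * cubic S"
proof -
  obtain i j k where S: "S = {i, j, k}" "i \<noteq> j" "i \<noteq> k" "j \<noteq> k"
    using assms(2) by (auto simp: card_3_iff)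
  have "S - {i} = {j, k}" "S - {j} = {i, k}" "S - {k} = {i, j}" using S by auto
  then have cubic: "cubic S = w {i, j, k} - (w {1, j, k} + (w {1, i, k} + w {1, i, j})) + (x1_sq_times i + (x1_sq_times j + x1_sq_times k)) - x1_cube"
    using S by (simp add: cubic_def)
  show ?thesis
    unfolding cubic using assms S
    by (simp add: Lap_linear Lap_w_three Lap_x1_sq_times Lap_x1_cube algebra_simps)
qed

lemma Lap_x1_times:
  assumes "p \<subseteq> {2..n}" "card p = 2"
  shows "Lap (x1_times p) = quadratic p - of_int theta3 * x1_times p"
proof -
  obtain i j where p: "p = {i, j}" "i \<noteq> j"
    using assms(2) by (auto simp: card_2_iff)
  show ?thesis
    using assms p by (simp add: x1_times_def quadratic_def Lap_linear Lap_w_three Lap_x1_sq_times Lap_x1_cube algebra_simps)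
qed

lemma Lap_quadratic:
  assumes "p \<subseteq> {2..n}" "card p = 2"
  shows "Lap (quadratic p) = - of_int theta2 * quadratic p"
proof -
  obtain i j where p: "p = {i, j}" "i \<noteq> j"
    using assms(2) by (auto simp: card_2_iff)
  show ?thesis
    using assms p by (simp add: quadratic_def Lap_linear Lap_w_two Lap_x1_sq algebra_simps)
qed

lemma Lap_x1_sq_times_diff:
  assumes "a \<in> {2..n}"
  shows "Lap (x1_sq_times a - x1_cube) = 2 * (w {1, a} - x1_sq) - (w {a} - w {1}) - of_int theta3 * (x1_sq_times a - x1_cube)"
  using assms by (simp add: Lap_linear Lap_x1_sq_times Lap_x1_cube algebra_simps)

lemma Lap_w_pair_diff:
  assumes "a \<in> {2..n}"
  shows "Lap (w {1, a} - x1_sq) = - of_int theta2 * (w {1, a} - x1_sq) - of_int m * (w {a} - w {1})"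
  using assms by (simp add: Lap_linear Lap_w_two Lap_x1_sq algebra_simps)

lemma Lap_w_point_diff:
  assumes "a \<in> {2..n}"
  shows "Lap (w {a} - w {1}) = - of_int theta1 * (w {a} - w {1})"
  using assms by (simp add: Lap_linear Lap_w_one algebra_simps)

section \<open>The vectors span\<close>

text \<open>
  The simplifier would otherwise turn 1 into \<open>Suc 0\<close> inside sets such as \<open>{1, a}\<close>.
\<close>

declare One_nat_def [simp del]

text \<open>
  The index sets of the sublattices of rank 3, 2 and 1. Leaving out the point \<open>n\<close> and the two
  pairs accounts for the linear relations among the \<open>w R\<close>, for instance that the \<open>w {i}\<close>
  sum to \<open>3 * w {}\<close>. For \<open>n = 7\<close> no triple is left.
\<close>

definition points :: "nat set" where "points = {2..n - 1}"

definition pairs :: "nat set set" where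
  "pairs = {p. p \<subseteq> {2..n - 1} \<and> card p = 2 \<and> p \<noteq> {2, 3} \<and> p \<noteq> {5, 6}}"

definition triples :: "nat set set" where
  "triples = {S. S \<subseteq> {2..n - 1} \<and> card S = 3 \<and> \<not> S \<subseteq> {2..6} \<and> \<not> {2, 3} \<subseteq> S \<and> \<not> {5, 6} \<subseteq> S}"

lemma finite_pairs: "finite pairs"
  by (rule finite_subset[of _ "Pow {2..n - 1}"]) (auto simp: pairs_def)

lemma pair_in_pairs:
  "i \<noteq> j \<Longrightarrow> {i, j} \<in> pairs \<longleftrightarrow> 2 \<le> i \<and> i < n \<and> 2 \<le> j \<and> j < n \<and> {i, j} \<noteq> {2, 3} \<and> {i, j} \<noteq> {5, 6}"
proof -
  have "a \<le> n - 1 \<longleftrightarrow> a < n" for a using n7 by linarith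
  then show "i \<noteq> j \<Longrightarrow> ?thesis" by (simp add: pairs_def)
qed

lemma w_apply: "w R S = of_bool (S \<in> V \<and> R \<subseteq> S)"
  by (simp add: w_def)

lemma V_ordered:
  assumes "T \<in> V"
  obtains i j k where "T = {i, j, k}" "1 \<le> i" "i < j" "j < k" "k \<le> n"
proof -
  obtain a b c where T: "T = {a, b, c}" "a \<noteq> b" "a \<noteq> c" "b \<noteq> c"
    using assms by (auto simp: V_iff card_3_iff)
  have range: "a \<in> {1..n}" "b \<in> {1..n}" "c \<in> {1..n}" using assms T by (auto simp: V_iff)
  consider "a < b" "b < c" | "a < c" "c < b" | "b < a" "a < c" | "b < c" "c < a" | "c < a" "a < b" | "c < b" "b < a"
    using T(2-4) by linarith
  then show thesis
  proof cases
    case 1 with T(1) range show thesis by (intro that[of a b c]) auto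
  next
    case 2 with T(1) range show thesis by (intro that[of a c b]) auto
  next
    case 3 with T(1) range show thesis by (intro that[of b a c]) auto
  next
    case 4 with T(1) range show thesis by (intro that[of b c a]) auto
  next
    case 5 with T(1) range show thesis by (intro that[of c a b]) auto
  next
    case 6 with T(1) range show thesis by (intro that[of c b a]) auto
  qed
qed

lemma triple_in_V: "1 \<le> i \<Longrightarrow> i < j \<Longrightarrow> j < k \<Longrightarrow> k \<le> n \<Longrightarrow> {i, j, k} \<in> V"
  by (auto simp: V_iff)

text \<open>
  The principle behind all membership proofs below: a function lies in a subgroup as soon as the
  unit vectors on its support do.
\<close>

lemma mem_of_support:
  assumes "zmod.subspace A" and "\<And>T. T \<in> V \<Longrightarrow> f T \<noteq> 0 \<Longrightarrow> w T \<in> A"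
    and "\<And>S. S \<notin> V \<Longrightarrow> f S = 0"
  shows "f \<in> A"
proof -
  have "f = (\<Sum>T\<in>V. of_int (f T) * w T)"
  proof
    fix S
    have "(\<Sum>T\<in>V. of_int (f T) * w T) S = (\<Sum>T\<in>V. f T * w T S)"
      by (simp add: sum_fun_apply)
    also have "\<dots> = (\<Sum>T\<in>V. if T = S then f T else 0)"
    proof (intro sum.cong refl)
      fix T assume "T \<in> V"
      have "T = S" if "S \<in> V" "T \<subseteq> S"
        using that \<open>T \<in> V\<close> by (intro card_subset_eq) (auto simp: V_iff intro: finite_subset)
      then show "f T * w T S = (if T = S then f T else 0)"
        using \<open>T \<in> V\<close> by (auto simp: w_def)
    qed
    also have "\<dots> = f S"
      using finite_V assms(3)[of S] by (simp add: sum.delta)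
    finally show "f S = (\<Sum>T\<in>V. of_int (f T) * w T) S" by simp
  qed
  moreover have "(\<Sum>T\<in>V. of_int (f T) * w T) \<in> A"
  proof (rule zmod.subspace_sum[OF assms(1)])
    fix T assume "T \<in> V"
    then show "of_int (f T) * w T \<in> A"
      using assms(2)[of T] zmod.subspace_scale[OF assms(1)] zmod.subspace_0[OF assms(1)]
      by (cases "f T = 0") auto
  qed
  ultimately show ?thesis by simp
qed

text \<open>
  Subtracting from \<open>w {a}\<close> the \<open>w p\<close> of the admissible pairs \<open>p\<close> through
  \<open>a\<close> leaves 0 on most triples through \<open>a\<close> and the last point \<open>n\<close>: the third
  point forms an admissible pair with \<open>a\<close>, except in a few cases. So the triples through
  \<open>n\<close>, which are reached last, drop out.
\<close>

definition minus_pairs :: "nat set \<Rightarrow> nat set set \<Rightarrow> nat set \<Rightarrow> int" where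
  "minus_pairs R P = w R - (\<Sum>p\<in>P. w p)"

lemma minus_pairs_apply:
  assumes "{i, j, k} \<in> V" "i < j" "j < k" "P \<subseteq> pairs"
  shows "minus_pairs R P {i, j, k} =
    of_bool (R \<subseteq> {i, j, k}) - (of_bool ({i, j} \<in> P) + of_bool ({i, k} \<in> P) + of_bool ({j, k} \<in> P))"
proof -
  have fin: "finite P" using assms(4) finite_pairs by (rule finite_subset)
  have pairs: "p \<in> {{i, j}, {i, k}, {j, k}} \<longleftrightarrow> p \<subseteq> {i, j, k}" if "p \<in> P" for p
  proof -
    have "card p = 2" using that assms(4) by (auto simp: pairs_def)
    then obtain a b where "p = {a, b}" "a \<noteq> b" by (auto simp: card_2_iff)
    then show ?thesis using assms(2,3) by (auto simp: doubleton_eq_iff)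
  qed
  have "(\<Sum>p\<in>P. w p) {i, j, k} = (\<Sum>p\<in>P. w p {i, j, k})"
    by (rule sum_fun_apply)
  also have "\<dots> = (\<Sum>p\<in>P. of_bool (p \<in> {{i, j}, {i, k}, {j, k}}))"
    by (intro sum.cong refl) (simp only: w_def assms(1) pairs simp_thms)
  also have "\<dots> = int (card (P \<inter> {{i, j}, {i, k}, {j, k}}))"
    by (simp only: of_bool_def sum.inter_restrict[OF fin, symmetric]) simp
  also have "\<dots> = (\<Sum>p\<in>{{i, j}, {i, k}, {j, k}}. of_bool (p \<in> P))"
    by (subst sum_of_bool_eq) (auto intro!: arg_cong[of _ _ card])
  also have "\<dots> = of_bool ({i, j} \<in> P) + (of_bool ({i, k} \<in> P) + of_bool ({j, k} \<in> P))"
    using assms(2,3) by (simp add: doubleton_eq_iff)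
  finally show ?thesis using assms(1) by (simp add: minus_pairs_def w_def)
qed

lemma pair_in_pairs_last:
  assumes "2 \<le> i" "i < j" "j < n" "\<not> (i = 2 \<and> j = 3)"
  shows "{i, j} \<in> pairs \<longleftrightarrow> \<not> (i = 5 \<and> j = 6)" "{i, n} \<notin> pairs" "{j, n} \<notin> pairs"
  using assms by (auto simp: pair_in_pairs doubleton_eq_iff)

lemma minus_star_last:
  assumes "2 \<le> i" "i < j" "j < n" "\<not> (i = 2 \<and> j = 3)" "a \<noteq> n"
  shows "minus_pairs {a} {p \<in> pairs. a \<in> p} {i, j, n} = of_bool (i = 5 \<and> j = 6 \<and> (a = 5 \<or> a = 6))"
proof -
  have "{i, j, n} \<in> V" "{p \<in> pairs. a \<in> p} \<subseteq> pairs" using assms by (auto intro: triple_in_V)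
  then show ?thesis
    using assms(2,3,5) pair_in_pairs_last[OF assms(1-4)] by (auto simp: minus_pairs_apply)
qed

lemma minus_all_last:
  assumes "2 \<le> i" "i < j" "j < n" "\<not> (i = 2 \<and> j = 3)"
  shows "minus_pairs {} pairs {i, j, n} = of_bool (i = 5 \<and> j = 6)"
proof -
  have "{i, j, n} \<in> V" using assms by (auto intro: triple_in_V)
  then show ?thesis
    using assms(2,3) pair_in_pairs_last[OF assms] by (simp add: minus_pairs_apply)
qed

lemma minus_pairs_off: "S \<notin> V \<Longrightarrow> minus_pairs R P S = 0"
  by (simp add: minus_pairs_def sum_fun_apply w_def)

text \<open>
  The triples whose unit vectors are easily seen to lie in the span. The remaining ones are listed
  in the next lemma.
\<close>

definition known :: "nat set \<Rightarrow> bool" where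
  "known T \<longleftrightarrow> 1 \<in> T \<or> {2, 3} \<subseteq> T \<or> T = {2, 4, 5} \<or> T = {3, 4, 6} \<or> T \<in> triples"

lemma not_known_cases:
  assumes "T \<in> V" "\<not> known T"
  obtains (last) i j where "2 \<le> i" "i < j" "j < n" "\<not> (i = 2 \<and> j = 3)" "T = {i, j, n}"
    | (small) "T = {2, 4, 6} \<or> T = {2, 5, 6} \<or> T = {3, 4, 5} \<or> T = {3, 5, 6} \<or> T = {4, 5, 6}"
    | (five_six) k where "7 \<le> k" "k < n" "T = {5, 6, k}"
proof -
  obtain i j k where T: "T = {i, j, k}" "1 \<le> i" "i < j" "j < k" "k \<le> n"
    using V_ordered[OF assms(1)] by blast
  have i: "2 \<le> i" and ij: "\<not> (i = 2 \<and> j = 3)" and ne: "T \<noteq> {2, 4, 5}" "T \<noteq> {3, 4, 6}" and triples: "T \<notin> triples"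
    using assms(2) T by (auto simp: known_def)
  consider "k = n" | "k < n" "7 \<le> k" | "k \<le> 6" using T by linarith
  then show thesis
  proof cases
    case 1
    then show ?thesis using last T i ij by blast
  next
    case 2
    have "T \<subseteq> {2..n - 1}" "card T = 3" "\<not> T \<subseteq> {2..6}" using T i 2 by auto
    moreover have "\<not> {2, 3} \<subseteq> T" using T i ij by auto
    ultimately have "{5, 6} \<subseteq> T" using triples by (auto simp: triples_def)
    then have "T = {5, 6, k}" using T 2 by auto
    then show ?thesis using five_six 2 by blast
  next
    case 3
    then have "i = 2 \<or> i = 3 \<or> i = 4" "j = 3 \<or> j = 4 \<or> j = 5" "k = 4 \<or> k = 5 \<or> k = 6"
      using T i by linarith+
    then have "T = {2, 4, 6} \<or> T = {2, 5, 6} \<or> T = {3, 4, 5} \<or> T = {3, 5, 6} \<or> T = {4, 5, 6}"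
      using T ij ne by (elim disjE) simp_all
    then show ?thesis by (rule small)
  qed
qed

text \<open>
  The unit vectors are obtained in several rounds. The triples through 1 come from the rank 2
  vectors, with those containing \<open>n\<close> and \<open>{1, 5, 6}\<close> supplied by \<open>w {1, a}\<close> and
  \<open>w {1}\<close>. Then \<open>w {2, 3}\<close> and the substitutes for \<open>x\<^sub>1\<^sup>2 x\<^sub>j\<close> yield the
  triples through 2 and 3 and the two triples \<open>{2, 4, 5}\<close> and \<open>{3, 4, 6}\<close>, and
  the rank 1 vectors yield the triples of the index set. The functions \<open>minus_pairs {a} _\<close> give first
  the triples \<open>{5, 6, k}\<close> and then a unimodular system of linear equations for the six unit
  vectors on \<open>{5, 6, n}\<close> and on the five triples inside \<open>{2..6}\<close> that are still
  missing. At last \<open>w {i, j}\<close> gives the triple \<open>{i, j, n}\<close>.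
\<close>

lemma spanning:
  assumes sub: "zmod.subspace A"
    and triples: "\<And>S. S \<in> triples \<Longrightarrow> {cubic S} \<subseteq> A"
    and pairs: "\<And>p. p \<in> pairs \<Longrightarrow> {x1_times p, quadratic p} \<subseteq> A"
    and points: "\<And>a. a \<in> points \<Longrightarrow> {x1_sq_times a - x1_cube, w {1, a} - x1_sq, w {a} - w {1}} \<subseteq> A"
    and bottom: "{x1_cube, x1_sq, w {1}, w {}} \<subseteq> A"
    and "T \<in> V"
  shows "w T \<in> A"
proof -
  have cubic: "cubic S \<in> A" if "S \<in> triples" for S using triples[OF that] by simp
  have su: "x1_times p \<in> A" "quadratic p \<in> A" if "p \<in> pairs" for p using pairs[OF that] by simp_all
  have pt: "x1_sq_times a - x1_cube \<in> A" "w {1, a} - x1_sq \<in> A" "w {a} - w {1} \<in> A" if "a \<in> points" for a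
    using points[OF that] by simp_all
  have base: "x1_cube \<in> A" "x1_sq \<in> A" "w {1} \<in> A" "w {} \<in> A" using bottom by simp_all
  note add = zmod.subspace_add[OF sub] and diff = zmod.subspace_diff[OF sub]
    and sum = zmod.subspace_sum[OF sub]
  note supp = mem_of_support[OF sub]
  have x1_sq_times: "x1_sq_times a \<in> A" if "a \<in> points" for a using add[OF pt(1)[OF that] base(1)] by simp
  have w1: "w {1, a} \<in> A" if "a \<in> points" for a using add[OF pt(2)[OF that] base(2)] by simp
  have wa: "w {a} \<in> A" if "a \<in> points" for a using add[OF pt(3)[OF that] base(3)] by simp
  have p1: "w (insert 1 p) \<in> A" and wp: "w p \<in> A" if "p \<in> pairs" for p
  proof -
    have "p \<subseteq> points" using that by (auto simp: pairs_def points_def)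
    then have "(\<Sum>i\<in>p. x1_sq_times i) \<in> A" "(\<Sum>i\<in>p. w {1, i}) \<in> A"
      by (auto intro!: sum x1_sq_times w1)
    then have "x1_times p + (\<Sum>i\<in>p. x1_sq_times i) - x1_cube \<in> A" "quadratic p + (\<Sum>i\<in>p. w {1, i}) - x1_sq \<in> A"
      using su that base add diff by blast+
    then show "w (insert 1 p) \<in> A" "w p \<in> A" by (simp_all add: x1_times_def quadratic_def)
  qed
  have "x1_sq_times 2 + x1_sq_times 3 - x1_cube \<in> A"
    using x1_sq_times n7 base add diff by (auto simp: points_def)
  then have w123: "w {1, 2, 3} \<in> A" by (simp add: x1_cube_def)
  have w1ij: "w {1, i, j} \<in> A" if "2 \<le> i" "i < j" "j < n" "\<not> (i = 5 \<and> j = 6)" for i j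
  proof (cases "i = 2 \<and> j = 3")
    case False
    then have "{i, j} \<in> pairs" using that by (subst pair_in_pairs) (auto simp: doubleton_eq_iff)
    then show ?thesis using p1 by simp
  qed (use w123 in simp)
  have w1an: "w {1, a, n} \<in> A" if "a \<in> points" "a \<noteq> 5" "a \<noteq> 6" for a
  proof -
    have "w {1, a} - w {1, a, n} \<in> A"
    proof (rule supp)
      fix T assume "T \<in> V" and T: "(w {1, a} - w {1, a, n}) T \<noteq> 0"
      obtain i j k where ijk: "T = {i, j, k}" "1 \<le> i" "i < j" "j < k" "k \<le> n"
        using V_ordered[OF \<open>T \<in> V\<close>] by blast
      then have "i = 1" "a = j \<or> a = k" "k \<noteq> n" 
        using T \<open>T \<in> V\<close> that by (auto simp: w_apply points_def of_bool_def split: if_splits)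
      then show "w T \<in> A" using ijk w1ij[of j k] that by auto
    qed (simp add: w_apply)
    from diff[OF w1[OF that(1)] this] show ?thesis by simp
  qed
  have w156n: "w {1, 5, 6} + w {1, a, n} \<in> A" if "a = 5 \<or> a = 6" for a
  proof -
    have "w {1, a} - (w {1, 5, 6} + w {1, a, n}) \<in> A"
    proof (rule supp)
      fix T assume "T \<in> V" and T: "(w {1, a} - (w {1, 5, 6} + w {1, a, n})) T \<noteq> 0"
      obtain i j k where ijk: "T = {i, j, k}" "1 \<le> i" "i < j" "j < k" "k \<le> n"
        using V_ordered[OF \<open>T \<in> V\<close>] by blast
      then have "i = 1" "k \<noteq> n" "\<not> (j = 5 \<and> k = 6)"
        using T \<open>T \<in> V\<close> that n7 by (auto simp: w_apply)
      then show "w T \<in> A" using ijk w1ij[of j k] by auto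
    qed (simp add: w_apply)
    moreover have "w {1, a} \<in> A" using w1 that n7 by (auto simp: points_def)
    ultimately show ?thesis using diff by fastforce
  qed
  have "w {1} - (w {1, 5, 6} + w {1, 5, n} + w {1, 6, n}) \<in> A"
  proof (rule supp)
    fix T assume "T \<in> V" and T: "(w {1} - (w {1, 5, 6} + w {1, 5, n} + w {1, 6, n})) T \<noteq> 0"
    obtain i j k where ijk: "T = {i, j, k}" "1 \<le> i" "i < j" "j < k" "k \<le> n"
      using V_ordered[OF \<open>T \<in> V\<close>] by blast
    then have "i = 1" "\<not> (j = 5 \<and> k = 6)" "\<not> (k = n \<and> (j = 5 \<or> j = 6))"
      using T \<open>T \<in> V\<close> n7 by (auto simp: w_apply)
    then show "w T \<in> A" using ijk w1ij[of j k] w1an[of j] n7 by (cases "k = n") (auto simp: points_def)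
  qed (simp add: w_apply)
  from diff[OF base(3) this] have sum3: "w {1, 5, 6} + w {1, 5, n} + w {1, 6, n} \<in> A"
    by (simp add: algebra_simps)
  \<comment> \<open>The two sums have \<open>w {1, 5, 6}\<close> in common, which therefore is their sum minus the total.\<close>
  have "w {1, 5, 6} + w {1, 5, n} + (w {1, 5, 6} + w {1, 6, n}) - (w {1, 5, 6} + w {1, 5, n} + w {1, 6, n}) \<in> A"
    using w156n sum3 add diff by blast
  then have w156: "w {1, 5, 6} \<in> A" by simp
  have w1n: "w {1, a, n} \<in> A" if "a \<in> points" for a
    using w1an[OF that] diff[OF w156n w156] by (cases "a = 5 \<or> a = 6") auto
  have one: "w T \<in> A" if T: "T \<in> V" "1 \<in> T" for T
  proof -
    obtain i j k where ijk: "T = {i, j, k}" "1 \<le> i" "i < j" "j < k" "k \<le> n"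
      using V_ordered[OF T(1)] by blast
    then have "i = 1" using T by auto
    then show ?thesis using ijk w1ij[of j k] w1n[of j] w156
      by (cases "k = n"; cases "j = 5 \<and> k = 6") (auto simp: points_def)
  qed
  have V1: "w {1, i, j} \<in> A" if "2 \<le> i" "i < j" "j \<le> n" for i j
    using one triple_in_V[of 1 i j] that by simp
  have w23j: "w {2, 3, j} \<in> A" if "4 \<le> j" "j < n" for j
  proof -
    have "w {1, 2, j} + w {1, 3, j} - x1_sq_times j \<in> A"
      using that by (intro diff add V1 x1_sq_times) (auto simp: points_def)
    then show ?thesis using that by (simp add: x1_sq_times_def)
  qed
  have "w {1, 2} + w {1, 3} - x1_sq \<in> A"
    using n7 by (intro diff add w1 base) (auto simp: points_def)
  then have w23: "w {2, 3} \<in> A" by (simp add: x1_sq_def)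
  have "w {2, 3} - w {2, 3, n} \<in> A"
  proof (rule supp)
    fix T assume "T \<in> V" and T: "(w {2, 3} - w {2, 3, n}) T \<noteq> 0"
    obtain i j k where ijk: "T = {i, j, k}" "1 \<le> i" "i < j" "j < k" "k \<le> n"
      using V_ordered[OF \<open>T \<in> V\<close>] by blast
    show "w T \<in> A"
    proof (cases "i = 1")
      case True
      then show ?thesis using one \<open>T \<in> V\<close> ijk by auto
    next
      case False
      then have "i = 2" "j = 3" "k \<noteq> n"
        using T ijk \<open>T \<in> V\<close> by (auto simp: w_apply of_bool_def split: if_splits)
      then show ?thesis using ijk w23j by auto
    qed
  qed (simp add: w_apply)
  from diff[OF w23 this] have w23n: "w {2, 3, n} \<in> A" by simp
  have two_three: "w T \<in> A" if T: "T \<in> V" "{2, 3} \<subseteq> T" for T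
  proof -
    obtain i j k where ijk: "T = {i, j, k}" "1 \<le> i" "i < j" "j < k" "k \<le> n"
      using V_ordered[OF T(1)] by blast
    consider "i = 1" | "i = 2" "j = 3" using T ijk by auto
    then show ?thesis
      by cases (use one T(1) ijk w23n w23j[of k] in \<open>cases "k = n"; auto\<close>)+
  qed
  have w23k: "w {2, 3, j} \<in> A" if "4 \<le> j" "j \<le> n" for j
    using two_three triple_in_V[of 2 3 j] that by simp
  have "x1_sq_times 2 - (w {1, 2, 3} + w {1, 2, 4} + w {1, 2, 6} - w {1, 4, 6} - w {2, 3, 4} - w {2, 3, 6}) \<in> A"
    using n7 by (intro diff add V1 w23k x1_sq_times) (auto simp: points_def)
  then have w346: "w {3, 4, 6} \<in> A" by (simp add: x1_sq_times_def)
  have "x1_sq_times 3 - (w {1, 2, 3} + w {1, 3, 4} + w {1, 3, 5} - w {1, 4, 5} - w {2, 3, 4} - w {2, 3, 5}) \<in> A"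
    using n7 by (intro diff add V1 w23k x1_sq_times) (auto simp: points_def)
  then have w245: "w {2, 4, 5} \<in> A" by (simp add: x1_sq_times_def)
  have w_triples: "w S \<in> A" if "S \<in> triples" for S
  proof -
    have S: "S \<subseteq> points" "finite S" "card S = 3" using that by (auto simp: triples_def points_def intro: finite_subset)
    have "w (insert 1 (S - {i})) \<in> A" if "i \<in> S" for i
    proof (rule one)
      have "1 \<notin> S" using S by (auto simp: points_def)
      then show "insert 1 (S - {i}) \<in> V" using S that n7 by (auto simp: V_iff points_def card_Diff_singleton)
    qed simp
    then have "cubic S + (\<Sum>i\<in>S. w (insert 1 (S - {i}))) - (\<Sum>i\<in>S. x1_sq_times i) + x1_cube \<in> A"
      using S cubic[OF that] by (intro diff add sum base x1_sq_times) auto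
    then show ?thesis by (simp add: cubic_def)
  qed
  have known: "w T \<in> A" if "T \<in> V" "known T" for T
    using that one two_three w245 w346 w_triples by (auto simp: known_def)
  have mp: "minus_pairs R P \<in> A" if "w R \<in> A" "P \<subseteq> pairs" for R P
    unfolding minus_pairs_def using that wp by (intro diff sum) auto
  have combine: "g \<in> A" if R: "w R \<in> A" and P: "P \<subseteq> pairs" and off: "\<And>S. S \<notin> V \<Longrightarrow> g S = 0"
    and eq: "\<And>T. T \<in> V \<Longrightarrow> \<not> known T \<Longrightarrow> w T \<notin> A \<Longrightarrow> minus_pairs R P T = g T" for R P g
  proof -
    have "minus_pairs R P - g \<in> A"
      by (rule supp) (use known eq off minus_pairs_off in force)+
    from diff[OF mp[OF R P] this] show ?thesis by simp
  qed
  \<comment> \<open>Every triple through \<open>k\<close> in \<open>{2..n - 1}\<close> without \<open>{2, 3}\<close> has value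
    \<open>1 - 2\<close>, and \<open>{5, 6, k}\<close> is the only one of them that is not known.\<close>
  have w56k: "w {5, 6, k} \<in> A" if k: "7 \<le> k" "k < n" for k
  proof -
    have "- w {5, 6, k} \<in> A"
    proof (rule combine[of "{k}" "{p \<in> pairs. k \<in> p}"])
      show "w {k} \<in> A" using wa k by (simp add: points_def)
      fix T assume T: "T \<in> V" "\<not> known T" "w T \<notin> A"
      from T(1,2) show "minus_pairs {k} {p \<in> pairs. k \<in> p} T = (- w {5, 6, k}) T"
      proof (cases rule: not_known_cases)
        case (last i j)
        then consider "k = i" | "k = j" | "k \<notin> T" using k by auto
        then show ?thesis
          by cases (use last T(1) k in \<open>simp_all add: minus_pairs_apply pair_in_pairs w_apply doubleton_eq_iff\<close>)
      next
        case small
        then have "k \<notin> T" using k by auto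
        then show ?thesis
          using small T(1) by (elim disjE) (simp_all add: minus_pairs_apply w_apply)
      next
        case (five_six l)
        then show ?thesis
          using T(1) k
          by (cases "k = l") (simp_all add: minus_pairs_apply pair_in_pairs w_apply doubleton_eq_iff)
      qed
    qed (auto simp: w_apply)
    then show ?thesis using zmod.subspace_neg[OF sub] by fastforce
  qed
  have small_V: "{2, 4, 6} \<in> V" "{2, 5, 6} \<in> V" "{3, 4, 5} \<in> V" "{3, 5, 6} \<in> V" "{4, 5, 6} \<in> V"
    "{5, 6, n} \<in> V"
    using n7 by (simp_all add: triple_in_V)
  have w_last: "w {2, 4, 6} {i, j, n} = 0" "w {2, 5, 6} {i, j, n} = 0" "w {3, 4, 5} {i, j, n} = 0"
    "w {3, 5, 6} {i, j, n} = 0" "w {4, 5, 6} {i, j, n} = 0" "w {5, 6, n} {i, j, n} = of_bool (i = 5 \<and> j = 6)"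
    if "2 \<le> i" "i < j" "j < n" for i j
    using that n7 triple_in_V[of i j n] by (auto simp: w_apply)
  have reduce: "g \<in> A" if R: "w R \<in> A" and P: "P \<subseteq> pairs" and off: "\<And>S. S \<notin> V \<Longrightarrow> g S = 0"
    and last: "\<And>i j. 2 \<le> i \<Longrightarrow> i < j \<Longrightarrow> j < n \<Longrightarrow> \<not> (i = 2 \<and> j = 3) \<Longrightarrow>
      minus_pairs R P {i, j, n} = g {i, j, n}"
    and small: "minus_pairs R P {2, 4, 6} = g {2, 4, 6}" "minus_pairs R P {2, 5, 6} = g {2, 5, 6}"
      "minus_pairs R P {3, 4, 5} = g {3, 4, 5}" "minus_pairs R P {3, 5, 6} = g {3, 5, 6}"
      "minus_pairs R P {4, 5, 6} = g {4, 5, 6}"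
    for R P g
  proof (rule combine[OF R P off])
    fix T assume T: "T \<in> V" "\<not> known T" "w T \<notin> A"
    from T(1,2) show "minus_pairs R P T = g T"
    proof (cases rule: not_known_cases)
      case last
      then show ?thesis using that(4) by blast
    next
      case small
      then show ?thesis using that(5-) by auto
    next
      case five_six
      then show ?thesis using w56k T(3) by blast
    qed
  qed
  note small_simps = minus_pairs_apply[OF small_V(1)] minus_pairs_apply[OF small_V(2)]
    minus_pairs_apply[OF small_V(3)] minus_pairs_apply[OF small_V(4)] minus_pairs_apply[OF small_V(5)]
    pair_in_pairs w_apply small_V doubleton_eq_iff
  \<comment> \<open>For \<open>a\<close> from 2 to 6 the value on the missing triples through \<open>a\<close> inside
    \<open>{2..6}\<close> is \<open>1 - 2\<close>, or \<open>1 - 1\<close> if \<open>a\<close> is 5 or 6 and the triple contains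
    both. In the latter two cases \<open>{5, 6, n}\<close> contains no admissible pair and has value 1.\<close>
  have a2: "- (w {2, 4, 6} + w {2, 5, 6}) \<in> A"
  proof (rule reduce[of "{2}" "{p \<in> pairs. 2 \<in> p}"])
    show "w {2} \<in> A" using wa n7 by (simp add: points_def)
  qed (use n7 in \<open>auto simp: minus_star_last w_last small_simps\<close>)
  have a3: "- (w {3, 4, 5} + w {3, 5, 6}) \<in> A"
  proof (rule reduce[of "{3}" "{p \<in> pairs. 3 \<in> p}"])
    show "w {3} \<in> A" using wa n7 by (simp add: points_def)
  qed (use n7 in \<open>auto simp: minus_star_last w_last small_simps\<close>)
  have a4: "- (w {2, 4, 6} + w {3, 4, 5} + w {4, 5, 6}) \<in> A"
  proof (rule reduce[of "{4}" "{p \<in> pairs. 4 \<in> p}"])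
    show "w {4} \<in> A" using wa n7 by (simp add: points_def)
  qed (use n7 in \<open>auto simp: minus_star_last w_last small_simps\<close>)
  have a5: "w {5, 6, n} - w {3, 4, 5} \<in> A"
  proof (rule reduce[of "{5}" "{p \<in> pairs. 5 \<in> p}"])
    show "w {5} \<in> A" using wa n7 by (simp add: points_def)
  qed (use n7 in \<open>auto simp: minus_star_last w_last small_simps\<close>)
  have a6: "w {5, 6, n} - w {2, 4, 6} \<in> A"
  proof (rule reduce[of "{6}" "{p \<in> pairs. 6 \<in> p}"])
    show "w {6} \<in> A" using wa n7 by (simp add: points_def)
  qed (use n7 in \<open>auto simp: minus_star_last w_last small_simps\<close>)
  have a0: "w {5, 6, n} - 2 * w {2, 4, 6} - 2 * w {3, 4, 5} - w {2, 5, 6} - w {3, 5, 6} - w {4, 5, 6} \<in> A"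
    by (rule reduce[of "{}" pairs]) (use base n7 in \<open>auto simp: minus_all_last w_last small_simps\<close>)
  \<comment> \<open>In the relation for the empty set the five triples inside \<open>{2..6}\<close> cancel against those
    in the relations for the points 2, 3 and 4.\<close>
  have w56n: "w {5, 6, n} \<in> A"
    using diff[OF diff[OF diff[OF a0 a2] a3] a4] by (simp add: algebra_simps)
  have w345: "w {3, 4, 5} \<in> A" using diff[OF w56n a5] by simp
  have w246: "w {2, 4, 6} \<in> A" using diff[OF w56n a6] by simp
  have w256: "w {2, 5, 6} \<in> A" using zmod.subspace_neg[OF sub add[OF a2 w246]] by simp
  have w356: "w {3, 5, 6} \<in> A" using zmod.subspace_neg[OF sub add[OF a3 w345]] by simp
  have w456: "w {4, 5, 6} \<in> A"
    using zmod.subspace_neg[OF sub add[OF add[OF a4 w345] w246]] by (simp add: algebra_simps)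
  have not_n: "w T \<in> A" if "T \<in> V" "n \<notin> T" for T
  proof (cases "known T")
    case False
    with that(1) show ?thesis
      by (cases rule: not_known_cases) (use that(2) w56k w246 w256 w345 w356 w456 in auto)
  qed (use known that in blast)
  have wijn: "w {i, j, n} \<in> A" if ij: "2 \<le> i" "i < j" "j < n" "\<not> (i = 2 \<and> j = 3)" for i j
  proof (cases "i = 5 \<and> j = 6")
    case False
    then have "{i, j} \<in> pairs" using ij by (simp add: pair_in_pairs doubleton_eq_iff)
    moreover have "w {i, j} - w {i, j, n} \<in> A"
    proof (rule supp)
      fix T assume "T \<in> V" and T: "(w {i, j} - w {i, j, n}) T \<noteq> 0"
      then have "n \<notin> T" by (auto simp: w_apply)
      with \<open>T \<in> V\<close> show "w T \<in> A" by (rule not_n)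
    qed (simp add: w_apply)
    ultimately show ?thesis using diff[OF wp] by fastforce
  qed (use w56n in simp)
  show ?thesis
  proof (cases "known T")
    case False
    with \<open>T \<in> V\<close> show ?thesis
      by (cases rule: not_known_cases) (use wijn w56k w246 w256 w345 w356 w456 in auto)
  qed (use known \<open>T \<in> V\<close> in blast)
qed

section \<open>Counting the index sets\<close>

lemma card_points: "card points = n - 2"
  using n7 by (simp add: points_def)

lemma card_pairs: "card pairs + 2 * n = (n choose 2) + 1"
proof -
  let ?P = "{p. p \<subseteq> {2..n - 1} \<and> card p = 2}"
  have "card ?P = (n - 2) choose 2"
    using n7 by (simp add: n_subsets)
  moreover have "pairs = ?P - {{2, 3}, {5, 6}}" by (auto simp: pairs_def)
  moreover have "{{2, 3}, {5, 6}} \<subseteq> ?P" using n7 by auto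
  moreover have "card {{2, 3}, {5::nat, 6}} = 2" by (simp add: doubleton_eq_iff)
  moreover have "finite ?P" by (rule finite_subset[of _ "Pow {2..n - 1}"]) auto
  ultimately have "card pairs = ((n - 2) choose 2) - 2" "2 \<le> (n - 2) choose 2"
    using card_Diff_subset[of "{{2, 3}, {5, 6}}" ?P] card_mono[of ?P "{{2, 3}, {5, 6}}"] by (simp_all only: finite.intros)
  then have "int (card pairs) = int ((n - 2) choose 2) - 2" by linarith
  moreover have "2 * int ((n - 2) choose 2) = (m + 3) * (m + 2)" "2 * int (n choose 2) = (m + 5) * (m + 4)"
    using two_choose_two[of "n - 2"] two_choose_two[of n] n7 by (simp_all add: m_def of_nat_diff)
  ultimately have "2 * int (card pairs + 2 * n) = 2 * int ((n choose 2) + 1)"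
    by (simp add: n_eq algebra_simps)
  then show ?thesis by (simp only: mult_cancel_left of_nat_eq_iff) simp
qed

text \<open>
  Of the triples in \<open>{2..n - 1}\<close> the 10 inside \<open>{2..6}\<close> are left out, and otherwise
  just those consisting of \<open>{2, 3}\<close> or \<open>{5, 6}\<close> and a point from
  \<open>{7..n - 1}\<close>.
\<close>

lemma card_triples: "card triples + 2 * (n choose 2) = (n choose 3) + n"
proof -
  let ?P = "{S. S \<subseteq> {2..n - 1} \<and> card S = 3}"
  let ?A = "{S. S \<subseteq> {2..6::nat} \<and> card S = 3}"
  let ?B = "(\<lambda>k. {2, 3, k}) ` {7..n - 1}" and ?C = "(\<lambda>k. {5, 6, k}) ` {7..n - 1}"
  have card_A: "card ?A = 10"
    by (simp add: n_subsets numeral_eq_Suc)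
  have "inj_on (\<lambda>k. {2, 3, k}) {7..n - 1}" "inj_on (\<lambda>k. {5, 6, k}) {7..n - 1}"
    by (auto simp: inj_on_def insert_eq_iff)
  then have card_BC: "card ?B = n - 7" "card ?C = n - 7"
    using n7 by (simp_all add: card_image)
  have "finite ?P" by (rule finite_subset[of _ "Pow {2..n - 1}"]) auto
  have "finite ?A" by (rule finite_subset[of _ "Pow {2..6}"]) auto
  have ne: "{2, 3, k} \<noteq> {5, 6, l}" for k l :: nat
  proof
    assume "{2, 3, k} = {5, 6, l}"
    then have "2 \<in> {5, 6, l}" "3 \<in> {5, 6, l}" by blast+
    then show False by simp
  qed
  have "\<not> {2, 3, k} \<subseteq> {2..6}" "\<not> {5, 6, k} \<subseteq> {2..6}" if "k \<in> {7..n - 1}" for k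
    using that by simp_all
  then have "?A \<inter> ?B = {}" "?A \<inter> ?C = {}" by blast+
  moreover have "?B \<inter> ?C = {}"
    using ne by (intro equals0I) (elim IntE imageE, metis)
  ultimately have disj: "?A \<inter> ?B = {}" "(?A \<union> ?B) \<inter> ?C = {}"
    by (simp_all only: Int_Un_distrib2 Un_empty_left)
  have sub: "?A \<union> ?B \<union> ?C \<subseteq> ?P"
  proof -
    have "{2..6} \<subseteq> {2..n - 1}" using n7 by auto
    then have "?A \<subseteq> ?P" by blast
    moreover have "?B \<union> ?C \<subseteq> ?P" using n7 by auto
    ultimately show ?thesis by blast
  qed
  have "triples = ?P - (?A \<union> ?B \<union> ?C)"
  proof (intro equalityI subsetI)
    fix S assume S: "S \<in> ?P - (?A \<union> ?B \<union> ?C)"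
    have third: "\<exists>k. S = {a, b, k} \<and> k \<noteq> a \<and> k \<noteq> b" if "{a, b} \<subseteq> S" "a \<noteq> b" for a b
    proof -
      have "card (S - {a, b}) = 1" using S that by (auto simp: card_Diff_subset finite_subset)
      then obtain k where "S - {a, b} = {k}" by (rule card_1_singletonE)
      then show ?thesis using that by blast
    qed
    have "\<not> {2, 3} \<subseteq> S"
    proof
      assume "{2, 3} \<subseteq> S"
      then obtain k where k: "S = {2, 3, k}" "k \<noteq> 2" "k \<noteq> 3" using third[of 2 3] by auto
      then have "k \<in> {2..n - 1}" using S by auto
      then have "k \<in> {7..n - 1} \<or> S \<subseteq> {2..6}" using k by auto
      then show False using S k by auto
    qed
    moreover have "\<not> {5, 6} \<subseteq> S"
    proof
      assume "{5, 6} \<subseteq> S"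
      then obtain k where k: "S = {5, 6, k}" "k \<noteq> 5" "k \<noteq> 6" using third[of 5 6] by auto
      then have "k \<in> {2..n - 1}" using S by auto
      then have "k \<in> {7..n - 1} \<or> S \<subseteq> {2..6}" using k by auto
      then show False using S k by auto
    qed
    ultimately show "S \<in> triples" using S unfolding triples_def by blast
  next
    fix S assume "S \<in> triples"
    then show "S \<in> ?P - (?A \<union> ?B \<union> ?C)" unfolding triples_def by blast
  qed
  then have "card triples = card ?P - card (?A \<union> ?B \<union> ?C)"
    using sub \<open>finite ?A\<close> by (simp add: card_Diff_subset)
  moreover have "card (?A \<union> ?B \<union> ?C) \<le> card ?P"
    using sub \<open>finite ?P\<close> by (rule card_mono[rotated])
  moreover have "card (?A \<union> ?B \<union> ?C) = 10 + (n - 7) + (n - 7)"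
    using disj card_A card_BC \<open>finite ?A\<close> by (simp add: card_Un_disjoint)
  moreover have "card ?P = (n - 2) choose 3"
    using n7 by (simp add: n_subsets)
  ultimately have "card triples + (10 + (n - 7) + (n - 7)) = (n - 2) choose 3"
    by (simp only: le_add_diff_inverse2)
  then have "int (card triples + (10 + (n - 7) + (n - 7))) = int ((n - 2) choose 3)"
    by (rule arg_cong)
  then have "int (card triples) = int ((n - 2) choose 3) - 10 - 2 * (int n - 7)"
    using n7 by (simp add: of_nat_diff)
  moreover have "6 * int ((n - 2) choose 3) = (m + 3) * (m + 2) * (m + 1)" "6 * int (n choose 3) = (m + 5) * (m + 4) * (m + 3)"
    "2 * int (n choose 2) = (m + 5) * (m + 4)"
    using six_choose_three[of "n - 2"] six_choose_three[of n] two_choose_two[of n] n7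
    by (simp_all add: m_def of_nat_diff)
  ultimately have "6 * int (card triples + 2 * (n choose 2)) = 6 * int ((n choose 3) + n)"
    by (simp add: n_eq algebra_simps)
  then show ?thesis by (simp only: mult_cancel_left of_nat_eq_iff) simp
qed

section \<open>Diagonalising the invariant sublattices\<close>

text \<open>
  A list of triples \<open>(b, c, e)\<close> that diagonalises the Laplacian on the sublattice spanned by
  \<open>G\<close>, which is covered by the source vectors as well as by the target vectors.
\<close>

definition block :: "((nat set \<Rightarrow> int) \<times> (nat set \<Rightarrow> int) \<times> int) list \<Rightarrow> (nat set \<Rightarrow> int) set \<Rightarrow> bool" where
  "block xs G \<longleftrightarrow> (\<forall>(b, c, e) \<in> set xs. Lap b = of_int e * c)
    \<and> G \<subseteq> zspan ((\<lambda>(b, c, e). b) ` set xs) \<and> G \<subseteq> zspan ((\<lambda>(b, c, e). c) ` set xs)"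

lemma block_triple:
  assumes "S \<in> triples"
  shows "block [(cubic S, - cubic S, theta3)] {cubic S}"
proof -
  have "{2..n - 1} \<subseteq> {2..n}" by auto
  then have "S \<subseteq> {2..n}" "card S = 3" using assms unfolding triples_def by blast+
  then have "Lap (cubic S) = of_int theta3 * (- cubic S)" by (simp add: Lap_cubic)
  then show ?thesis
    unfolding block_def by (auto intro: zmod.span_base zspan_minusD)
qed

text \<open>
  With respect to the source basis \<open>x1_times p, quadratic p\<close> the matrix has a unit entry, so the
  image of \<open>x1_times p\<close> can replace \<open>quadratic p\<close> as a target vector.
\<close>

lemma block_pair:
  assumes "p \<in> pairs"
  shows "block [(x1_times p, quadratic p - of_int theta3 * x1_times p, 1), (quadratic p + of_int theta2 * x1_times p, - x1_times p, theta2 * theta3)] {x1_times p, quadratic p}"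
proof -
  have "{2..n - 1} \<subseteq> {2..n}" by auto
  then have p: "p \<subseteq> {2..n}" "card p = 2" using assms unfolding pairs_def by blast+
  let ?b = "{x1_times p, quadratic p + of_int theta2 * x1_times p}" and ?c = "{quadratic p - of_int theta3 * x1_times p, - x1_times p}"
  have "x1_times p \<in> zspan ?b" by (rule zmod.span_base) simp
  moreover have "(quadratic p + of_int theta2 * x1_times p) - of_int theta2 * x1_times p \<in> zspan ?b"
    by (intro zmod.span_diff zspan_of_int_mult zmod.span_base) auto
  moreover have c: "x1_times p \<in> zspan ?c" by (rule zspan_minusD, rule zmod.span_base) simp
  moreover have "(quadratic p - of_int theta3 * x1_times p) + of_int theta3 * x1_times p \<in> zspan ?c"
    by (intro zmod.span_add zspan_of_int_mult c zmod.span_base) auto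
  moreover have "Lap (quadratic p + of_int theta2 * x1_times p) = of_int (theta2 * theta3) * (- x1_times p)"
    by (simp add: Lap_linear Lap_x1_times[OF p] Lap_quadratic[OF p] algebra_simps)
  ultimately show ?thesis
    unfolding block_def by (simp add: Lap_x1_times[OF p])
qed

lemma theta_pos: "0 < theta1" "0 < theta2" "0 < theta3"
proof -
  have "0 < 6 * theta1" "0 < 6 * theta2" "0 < 6 * theta3"
    unfolding theta1_eq theta2_eq theta3_eq using m_ge by (auto intro!: mult_pos_pos add_nonneg_pos)
  then show "0 < theta1" "0 < theta2" "0 < theta3" by simp_all
qed

text \<open>
  The image \<open>c\<close> of \<open>p\<close> replaces \<open>x\<close> as a target vector, and multiples
  of \<open>p\<close> are subtracted from the other source vectors so that their images do not involve
  \<open>c\<close>. The rest is a two by two matrix with respect to the target vectors \<open>p\<close> and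
  \<open>v\<close>.
\<close>

lemma block_point:
  assumes a: "a \<in> {2..n}" and D: "Kneser3_X (int n) * D = theta1 * theta2 * theta3"
  shows "\<exists>xs. block xs {x1_sq_times a - x1_cube, w {1, a} - x1_sq, w {a} - w {1}} \<and>
    map (\<lambda>(b, c, e). e) xs = [1, Kneser3_X (int n), D]"
proof -
  define p where "p = x1_sq_times a - x1_cube"
  define v where "v = w {1, a} - x1_sq"
  define x where "x = w {a} - w {1}"
  note L = Lap_x1_sq_times_diff[OF a, folded p_def v_def x_def] Lap_w_pair_diff[OF a, folded v_def x_def]
    Lap_w_point_diff[OF a, folded x_def]
  define c where "c = Lap p"
  have x_eq: "x = 2 * v - of_int theta3 * p - c" unfolding c_def L by simp
  have 1: "Lap (v - of_int m * p) = of_int (m * theta3) * p + of_int (- (theta2 + 2 * m)) * v"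
    unfolding Lap_linear L by (simp add: algebra_simps)
  have 2: "Lap (x - of_int theta1 * p) = of_int (theta1 * theta3) * p + of_int (- 2 * theta1) * v"
    unfolding Lap_linear L by (simp add: algebra_simps)
  have det: "m * theta3 * (- 2 * theta1) - (- (theta2 + 2 * m)) * (theta1 * theta3) = Kneser3_X (int n) * D"
    unfolding D by (simp add: algebra_simps)
  have "theta1 * theta2 * theta3 \<noteq> 0" using theta_pos by simp
  then have nz: "m * theta3 * (- 2 * theta1) - (- (theta2 + 2 * m)) * (theta1 * theta3) \<noteq> 0"
    unfolding det D .
  obtain s1 s2 t1 t2 where st: "Lap s1 = of_int (Kneser3_X (int n)) * t1" "Lap s2 = of_int D * t2"
    "{v - of_int m * p, x - of_int theta1 * p} \<subseteq> zspan {s1, s2}" "{p, v} \<subseteq> zspan {t1, t2}"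
    using smith_form_rank_two[OF Lap_add Lap_scale 1 2 X_gcd det nz] by (elim exE conjE) (rule that)
  let ?xs = "[(p, c, 1), (s1, t1, Kneser3_X (int n)), (s2, t2, D)]"
  have "zspan {s1, s2} \<subseteq> zspan {p, s1, s2}" "zspan {t1, t2} \<subseteq> zspan {c, t1, t2}"
    by (intro zmod.span_mono; auto)+
  then have b: "v - of_int m * p \<in> zspan {p, s1, s2}" "x - of_int theta1 * p \<in> zspan {p, s1, s2}" "p \<in> zspan {p, s1, s2}"
    and c: "p \<in> zspan {c, t1, t2}" "v \<in> zspan {c, t1, t2}" "c \<in> zspan {c, t1, t2}"
    using st by (auto intro: zmod.span_base)
  have "{p, v, x} \<subseteq> zspan {p, s1, s2}"
    using zmod.span_add[OF b(1) zspan_of_int_mult[OF b(3), of m]]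
      zmod.span_add[OF b(2) zspan_of_int_mult[OF b(3), of theta1]] b(3) by simp
  moreover have "x \<in> zspan {c, t1, t2}"
    unfolding x_eq using zspan_of_int_mult[OF c(2), of 2] zspan_of_int_mult[OF c(1)] c(3)
    by (intro zmod.span_diff) simp_all
  ultimately have "block ?xs {p, v, x}"
    using st c by (simp add: block_def c_def)
  then show ?thesis
    by (intro exI[of _ ?xs] conjI) (simp_all only: p_def v_def x_def list.map prod.case)
qed

text \<open>
  As in the rank 3 case the image of \<open>x1_cube\<close> replaces the constant \<open>w {}\<close> as a target
  vector. The coordinate sums of \<open>x1_cube\<close>, \<open>x1_sq\<close> and \<open>w {1}\<close> are \<open>1\<close>,
  \<open>m + 3\<close> and \<open>k\<close>. Since images of the Laplacian have coordinate sum 0, they are combinations of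
  \<open>x1_sq - (m + 3) * x1_cube\<close> and \<open>w {1} - k * x1_cube\<close>. This is the content of
  \<open>r1\<close> and \<open>r2\<close>, and it frees \<open>x1_cube\<close> to be the target vector that belongs to
  the diagonal entry 0.
\<close>

lemma block_base:
  assumes D: "Kneser3_Y (int n) * D = (theta2 + 3 * m) * (theta1 - 3 * c2) + 3 * c2 * m" and "D \<noteq> 0"
  shows "\<exists>xs. block xs {x1_cube, x1_sq, w {1}, w {}} \<and>
    map (\<lambda>(b, c, e). e) xs = [1, Kneser3_Y (int n), D, 0]"
proof -
  define k where "k = int ((n - 1) choose 2)"
  have k_eq: "2 * k = (m + 4) * (m + 3)"
    using two_choose_two[of "n - 1"] n7 by (simp add: k_def m_def of_nat_diff)
  have r1: "m * theta3 = (theta2 + 3 * m) * (m + 3) - m * k"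
  proof -
    have "6 * (m * theta3) = m * (6 * theta3)" by simp
    also have "\<dots> = (6 * theta2 + 18 * m) * (m + 3) - 3 * m * (2 * k)"
      unfolding theta3_eq theta2_eq k_eq by (simp add: algebra_simps power2_eq_square)
    finally show ?thesis by (simp add: algebra_simps)
  qed
  have r2: "c2 * theta3 = 3 * c2 * (m + 3) - (3 * c2 - theta1) * k"
  proof -
    have "12 * (c2 * theta3) = (2 * c2) * (6 * theta3)" by simp
    also have "\<dots> = 18 * (2 * c2) * (m + 3) - (9 * (2 * c2) - 6 * theta1) * (2 * k)"
      unfolding theta3_eq theta1_eq k_eq c2_eq by (simp add: algebra_simps power2_eq_square)
    finally show ?thesis by (simp add: algebra_simps)
  qed
  define c where "c = Lap x1_cube"
  have L1: "Lap (w {1}) = of_int c2 * w {} - of_int theta1 * w {1}"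
    using n7 by (intro Lap_w_one) simp
  have w0: "w {} = c + of_int theta3 * x1_cube - 3 * x1_sq + 3 * w {1}"
    by (simp add: c_def Lap_x1_cube)
  have 1: "Lap (x1_sq - of_int m * x1_cube) = of_int (- (theta2 + 3 * m)) * (x1_sq - of_int (m + 3) * x1_cube) + of_int m * (w {1} - of_int k * x1_cube)"
  proof -
    have "Lap (x1_sq - of_int m * x1_cube) = of_int (m * theta3) * x1_cube - of_int (theta2 + 3 * m) * x1_sq + of_int m * w {1}"
      unfolding Lap_linear Lap_x1_sq Lap_x1_cube by (simp add: algebra_simps)
    then show ?thesis unfolding r1 by (simp add: algebra_simps)
  qed
  have 2: "Lap (w {1} - of_int c2 * x1_cube) = of_int (- 3 * c2) * (x1_sq - of_int (m + 3) * x1_cube) + of_int (3 * c2 - theta1) * (w {1} - of_int k * x1_cube)"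
  proof -
    have "Lap (w {1} - of_int c2 * x1_cube) = of_int (c2 * theta3) * x1_cube - of_int (3 * c2) * x1_sq + of_int (3 * c2 - theta1) * w {1}"
      unfolding Lap_linear L1 Lap_x1_cube by (simp add: algebra_simps)
    then show ?thesis unfolding r2 by (simp add: algebra_simps)
  qed
  have det: "- (theta2 + 3 * m) * (3 * c2 - theta1) - m * (- 3 * c2) = Kneser3_Y (int n) * D"
    unfolding D by (simp add: algebra_simps)
  have "Kneser3_Y (int n) \<noteq> 0" using m_ge by (simp add: Y_eq)
  then have nz: "- (theta2 + 3 * m) * (3 * c2 - theta1) - m * (- 3 * c2) \<noteq> 0"
    unfolding det using \<open>D \<noteq> 0\<close> by simp
  obtain s1 s2 t1 t2 where st: "Lap s1 = of_int (Kneser3_Y (int n)) * t1" "Lap s2 = of_int D * t2"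
    "{x1_sq - of_int m * x1_cube, w {1} - of_int c2 * x1_cube} \<subseteq> zspan {s1, s2}"
    "{x1_sq - of_int (m + 3) * x1_cube, w {1} - of_int k * x1_cube} \<subseteq> zspan {t1, t2}"
    using smith_form_rank_two[OF Lap_add Lap_scale 1 2 Y_gcd det nz] by (elim exE conjE) (rule that)
  let ?xs = "[(x1_cube, c, 1), (s1, t1, Kneser3_Y (int n)), (s2, t2, D), (w {}, x1_cube, 0)]"
  let ?b = "{x1_cube, s1, s2, w {}}" and ?c = "{c, t1, t2, x1_cube}"
  have "zspan {s1, s2} \<subseteq> zspan ?b" "zspan {t1, t2} \<subseteq> zspan ?c"
    by (intro zmod.span_mono; auto)+
  then have b: "x1_sq - of_int m * x1_cube \<in> zspan ?b" "w {1} - of_int c2 * x1_cube \<in> zspan ?b"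
    "x1_cube \<in> zspan ?b" "w {} \<in> zspan ?b"
    and c: "x1_sq - of_int (m + 3) * x1_cube \<in> zspan ?c" "w {1} - of_int k * x1_cube \<in> zspan ?c" "x1_cube \<in> zspan ?c" "c \<in> zspan ?c"
    using st by (auto intro: zmod.span_base)
  have "{x1_cube, x1_sq, w {1}, w {}} \<subseteq> zspan ?b"
    using zmod.span_add[OF b(1) zspan_of_int_mult[OF b(3), of m]]
      zmod.span_add[OF b(2) zspan_of_int_mult[OF b(3), of c2]] b(3,4) by simp
  moreover have qw: "x1_sq \<in> zspan ?c" "w {1} \<in> zspan ?c"
    using zmod.span_add[OF c(1) zspan_of_int_mult[OF c(3), of "m + 3"]]
      zmod.span_add[OF c(2) zspan_of_int_mult[OF c(3), of k]] by simp_all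
  moreover have "w {} \<in> zspan ?c"
    unfolding w0 using zspan_of_int_mult[OF qw(1), of 3] zspan_of_int_mult[OF qw(2), of 3] zspan_of_int_mult[OF c(3)] c(4)
    by (intro zmod.span_diff zmod.span_add) simp_all
  ultimately have "block ?xs {x1_cube, x1_sq, w {1}, w {}}"
    using st c by (simp add: block_def c_def Lap_w_empty)
  then show ?thesis by (intro exI[of _ ?xs]) simp
qed

section \<open>The diagonal form\<close>

lemma X_dvd_product: "Kneser3_X (int n) dvd theta1 * theta2 * theta3"
proof -
  let ?X = "Kneser3_X (int n)"
  have "?X dvd theta2 + 2 * m" "?X dvd 2 * theta1" "?X dvd theta3 * theta1"
    unfolding X_eq by (metis gcd_dvd1 gcd_dvd2 dvd_trans)+
  then have "?X dvd theta2 * (theta3 * theta1)" by simp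
  then show ?thesis by (simp add: mult_ac)
qed

lemma X_nonzero: "Kneser3_X (int n) \<noteq> 0"
  using theta_pos by (simp add: X_eq)

lemma Y_dvd_product: "Kneser3_Y (int n) dvd (theta2 + 3 * m) * (theta1 - 3 * c2) + 3 * c2 * m"
proof -
  have "Kneser3_Y (int n) dvd - (theta2 + 3 * m)" "Kneser3_Y (int n) dvd m"
    unfolding Y_gcd by (metis gcd_dvd1 gcd_dvd2 dvd_trans)+
  then have "Kneser3_Y (int n) dvd theta2 + 3 * m" "Kneser3_Y (int n) dvd m"
    by (simp_all only: dvd_minus_iff)
  then have "Kneser3_Y (int n) dvd (theta2 + 3 * m) * (theta1 - 3 * c2)" "Kneser3_Y (int n) dvd 3 * c2 * m"
    by (simp_all only: dvd_mult2 dvd_mult)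
  then show ?thesis by (rule dvd_add)
qed

text \<open>
  On the left-hand side is 36 times the determinant of the two by two matrix of the rank 4 sublattice.
  This determinant equals
  \<open>theta1 * theta2 * theta3\<close> divided by the number of triples, which is the coordinate
  sum of the kernel vector \<open>w {}\<close>.
\<close>

lemma det_base:
  "36 * ((theta2 + 3 * m) * (theta1 - 3 * c2) + 3 * c2 * m) = (m^2 + 2) * (m + 1) * m^2 * (m - 1)"
proof -
  have "36 * ((theta2 + 3 * m) * (theta1 - 3 * c2) + 3 * c2 * m) =
      (6 * theta2 + 18 * m) * (6 * theta1 - 9 * (2 * c2)) + 54 * (2 * c2) * m"
    by (simp add: algebra_simps)
  also have "\<dots> = (m^2 + 2) * (m + 1) * m^2 * (m - 1)"
    unfolding theta2_eq theta1_eq c2_eq by (simp add: algebra_simps power2_eq_square)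
  finally show ?thesis .
qed

lemma det_points:
  "216 * (theta1 * theta2 * theta3) = (m^2 + 2) * (m + 4) * (m + 3) * (m + 1) * m^2 * (m - 1) * (m + 5)"
proof -
  have "216 * (theta1 * theta2 * theta3) = (6 * theta1) * (6 * theta2) * (6 * theta3)" by simp
  also have "\<dots> = (m^2 + 2) * (m + 4) * (m + 3) * (m + 1) * m^2 * (m - 1) * (m + 5)"
    unfolding theta1_eq theta2_eq theta3_eq by (simp add: algebra_simps power2_eq_square)
  finally show ?thesis .
qed

lemma entries_eq:
  assumes D1: "Kneser3_X (int n) * D1 = theta1 * theta2 * theta3"
    and D2: "Kneser3_Y (int n) * D2 = (theta2 + 3 * m) * (theta1 - 3 * c2) + 3 * c2 * m"
  shows "Kneser3_entries n = image_mset rat_of_int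
    (replicate_mset (card triples) theta3 + replicate_mset (card pairs) (theta2 * theta3)
      + replicate_mset (card pairs + card points + 1) 1 + replicate_mset (card points) D1
      + replicate_mset (card points) (Kneser3_X (int n))
      + {#D2, Kneser3_Y (int n), 0#})"
proof -
  define M where "M = rat_of_int m"
  have N: "rat_of_nat n = M + 5"
    using arg_cong[OF n_eq, of rat_of_int] by (simp add: M_def)
  have t3: "rat_of_int theta3 = (M^2 + 2) * (M + 3) / 6"
    using arg_cong[OF theta3_eq, of rat_of_int] by (simp add: M_def)
  have t2: "rat_of_int theta2 = M * (M + 4) * (M - 1) / 6"
    using arg_cong[OF theta2_eq, of rat_of_int] by (simp add: M_def)
  have X: "rat_of_int (Kneser3_X (int n)) \<noteq> 0" using X_nonzero by simp
  have Y: "rat_of_int (Kneser3_Y (int n)) \<noteq> 0" using m_ge by (simp add: Y_eq)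
  have "216 * (Kneser3_X (int n) * D1) = (m^2 + 2) * (m + 4) * (m + 3) * (m + 1) * m^2 * (m - 1) * (m + 5)"
    unfolding D1 by (rule det_points)
  from arg_cong[OF this, of rat_of_int]
  have d1: "rat_of_int D1 = 1 / rat_of_int (Kneser3_X (int n)) * (1 / 216) *
      ((M^2 + 2) * (M + 4) * (M + 3) * (M + 1) * M^2 * (M - 1) * (M + 5))"
    using X by (simp add: M_def field_simps)
  have "36 * (Kneser3_Y (int n) * D2) = (m^2 + 2) * (m + 1) * m^2 * (m - 1)"
    unfolding D2 by (rule det_base)
  from arg_cong[OF this, of rat_of_int]
  have d2: "rat_of_int D2 = 1 / rat_of_int (Kneser3_Y (int n)) * (1 / 36) *
      ((M^2 + 2) * (M + 1) * M^2 * (M - 1))"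
    using Y by (simp add: M_def field_simps)
  have quad: "(M + 5)^2 - 10 * (M + 5) + 27 = M^2 + 2"
    by (simp add: power2_eq_square algebra_simps)
  have e1: "1/6 * (M^2 + 2) * (M + 5 - 2) = rat_of_int theta3"
    unfolding t3 by simp
  have e2: "1/36 * (M^2 + 2) * (M + 5 - 1) * (M + 5 - 2) * (M + 5 - 5) * (M + 5 - 6) = rat_of_int (theta2 * theta3)"
    unfolding of_int_mult t3 t2 by (simp add: field_simps power2_eq_square)
  have e4: "1 / rat_of_int (Kneser3_X (int n)) * (1/216) * (M^2 + 2) * (M + 5 - 1) * (M + 5 - 2) * (M + 5 - 4)
      * (M + 5 - 5)^2 * (M + 5 - 6) * (M + 5) = rat_of_int D1"
    unfolding d1 by (simp add: ac_simps)
  have e5: "1 / rat_of_int (Kneser3_Y (int n)) * (1/36) * (M^2 + 2) * (M + 5 - 4) * (M + 5 - 5)^2 * (M + 5 - 6)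
      = rat_of_int D2"
    unfolding d2 by (simp add: mult_ac)
  have mult: "(n choose 3) + n - 2 * (n choose 2) = card triples" "(n choose 2) + 1 - 2 * n = card pairs"
    "(n choose 2) - n = card pairs + card points + 1" "n - 2 = card points"
    using card_points card_pairs card_triples n7 by linarith+
  show ?thesis
    unfolding Kneser3_entries_def Let_def N quad e1 e2 e4 e5 mult
    by (simp add: ac_simps One_nat_def)
qed

lemma diagonal_form_exists:
  assumes vs: "Gamma_enum n 3 vs"
  shows "\<exists>D. diagonal_form (Kneser3_laplacian n vs) D \<and>
             image_mset rat_of_int (mset (diag_mat D)) = Kneser3_entries n"
proof -
  have dist: "distinct vs" and set_vs: "set vs = V"
    using vs by (auto simp: Gamma_enum_def V_def)
  have len: "length vs = n choose 3"
    using distinct_card[OF dist] by (simp add: set_vs V_def Gamma_vertices_def n_subsets)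
  obtain D1 where D1: "Kneser3_X (int n) * D1 = theta1 * theta2 * theta3"
    using X_dvd_product by (metis dvdE)
  obtain D2 where D2: "Kneser3_Y (int n) * D2 = (theta2 + 3 * m) * (theta1 - 3 * c2) + 3 * c2 * m"
    using Y_dvd_product by (metis dvdE)
  have "36 * (Kneser3_Y (int n) * D2) \<noteq> 0"
    unfolding D2 det_base using m_ge by (auto simp: add_nonneg_eq_0_iff)
  then have "D2 \<noteq> 0" by auto
  obtain z where z: "block z {x1_cube, x1_sq, w {1}, w {}}" "map (\<lambda>(b, c, e). e) z = [1, Kneser3_Y (int n), D2, 0]"
    using block_base[OF D2 \<open>D2 \<noteq> 0\<close>] by (elim exE conjE) (rule that)
  have "\<forall>a\<in>points. \<exists>xs. block xs {x1_sq_times a - x1_cube, w {1, a} - x1_sq, w {a} - w {1}} \<and>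
      map (\<lambda>(b, c, e). e) xs = [1, Kneser3_X (int n), D1]"
    using block_point[OF _ D1] by (auto simp: points_def)
  then obtain f where f: "\<And>a. a \<in> points \<Longrightarrow> block (f a) {x1_sq_times a - x1_cube, w {1, a} - x1_sq, w {a} - w {1}}"
    "\<And>a. a \<in> points \<Longrightarrow> map (\<lambda>(b, c, e). e) (f a) = [1, Kneser3_X (int n), D1]"
    by metis
  define h where "h p = [(x1_times p, quadratic p - of_int theta3 * x1_times p, 1), (quadratic p + of_int theta2 * x1_times p, - x1_times p, theta2 * theta3)]" for p
  define k where "k S = [(cubic S, - cubic S, theta3)]" for S
  have "finite points" by (simp add: points_def)
  then obtain l1 where l1: "set l1 = points" "distinct l1" using finite_distinct_list by blast
  obtain l2 where l2: "set l2 = pairs" "distinct l2" using finite_distinct_list[OF finite_pairs] by blast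
  have "finite triples" by (rule finite_subset[of _ "Pow {2..n - 1}"]) (auto simp: triples_def)
  then obtain l3 where l3: "set l3 = triples" "distinct l3" using finite_distinct_list by blast
  have length_l: "length l1 = card points" "length l2 = card pairs" "length l3 = card triples"
    using l1 l2 l3 distinct_card by metis+
  define xs where "xs = concat (map k l3) @ concat (map h l2) @ concat (map f l1) @ z"
  have diag: "mset (map (\<lambda>(b, c, e). e) xs) = replicate_mset (card triples) theta3 + replicate_mset (card pairs) (theta2 * theta3)
      + replicate_mset (card pairs + card points + 1) 1 + replicate_mset (card points) D1
      + replicate_mset (card points) (Kneser3_X (int n))
      + {#D2, Kneser3_Y (int n), 0#}"
  proof -
    have "mset (map (\<lambda>(b, c, e). e) (concat (map k l3))) = repeat_mset (card triples) {#theta3#}"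
      "mset (map (\<lambda>(b, c, e). e) (concat (map h l2))) = repeat_mset (card pairs) {#1, theta2 * theta3#}"
      "mset (map (\<lambda>(b, c, e). e) (concat (map f l1))) = repeat_mset (card points) {#1, Kneser3_X (int n), D1#}"
      unfolding length_l[symmetric]
      by (rule mset_map_concat_const, simp add: k_def, rule mset_map_concat_const, simp add: h_def,
          rule mset_map_concat_const, simp only: f(2) l1 mset.simps)
    then show ?thesis
      unfolding xs_def map_append mset_append z(2)
      by (simp add: multiset_eq_iff)
  qed
  have len_xs: "length xs = length vs"
  proof -
    have "length xs = size (mset (map (\<lambda>(b, c, e). e) xs))" by simp
    also have "\<dots> = card triples + 2 * card pairs + 3 * card points + 4"
      unfolding diag by simp
    also have "\<dots> = length vs"
      using card_points card_pairs card_triples n7 len by linarith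
    finally show ?thesis .
  qed
  have blocks: "G \<subseteq> zspan ((\<lambda>(b, c, e). b) ` set xs)" "G \<subseteq> zspan ((\<lambda>(b, c, e). c) ` set xs)"
    if B: "block b G" "set b \<subseteq> set xs" for b G
    using B(1) zmod.span_mono[OF image_mono[OF B(2)], of "\<lambda>(b, c, e). b"]
      zmod.span_mono[OF image_mono[OF B(2)], of "\<lambda>(b, c, e). c"]
    unfolding block_def by blast+
  have bk: "block (k S) {cubic S}" "set (k S) \<subseteq> set xs" if "S \<in> triples" for S
    using block_triple[OF that] that l3 by (auto simp: k_def xs_def)
  have bh: "block (h p) {x1_times p, quadratic p}" "set (h p) \<subseteq> set xs" if "p \<in> pairs" for p
    using block_pair[OF that] that l2 by (auto simp: h_def xs_def)
  have bf: "set (f a) \<subseteq> set xs" if "a \<in> points" for a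
    using that l1 by (auto simp: xs_def)
  have bz: "set z \<subseteq> set xs" by (auto simp: xs_def)
  have cover: "w T \<in> A"
    if A: "zmod.subspace A" and G: "\<And>b G. block b G \<Longrightarrow> set b \<subseteq> set xs \<Longrightarrow> G \<subseteq> A" and T: "T \<in> V" for A T
  proof (rule spanning[OF A _ _ _ _ T])
    show "{cubic S} \<subseteq> A" if "S \<in> triples" for S using bk[OF that] by (rule G)
    show "{x1_times p, quadratic p} \<subseteq> A" if "p \<in> pairs" for p using bh[OF that] by (rule G)
    show "{x1_sq_times a - x1_cube, w {1, a} - x1_sq, w {a} - w {1}} \<subseteq> A" if "a \<in> points" for a
      using f(1)[OF that] bf[OF that] by (rule G)
    show "{x1_cube, x1_sq, w {1}, w {}} \<subseteq> A" using z(1) bz by (rule G)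
  qed
  have delta: "(\<lambda>U. of_bool (U = T)) = w T" if "T \<in> V" for T
  proof
    fix U
    have "T = U" if "U \<in> V" "T \<subseteq> U"
      using that \<open>T \<in> V\<close> by (intro card_subset_eq) (auto simp: V_iff intro: finite_subset)
    then show "of_bool (U = T) = w T U"
      using \<open>T \<in> V\<close> by (auto simp: w_def)
  qed
  have "\<exists>D. diagonal_form (Kneser3_laplacian n vs) D \<and> diag_mat D = map (\<lambda>(b, c, e). e) xs"
  proof (rule diagonal_form_from_bases[where K = "\<lambda>S T. of_bool (S \<inter> T = {}) - deg * of_bool (S = T)"])
    have "(if Gamma_adj 0 S T then 1 else 0) = (of_bool (S \<inter> T = {}) :: int)" if "S \<in> V" "T \<in> V" for S T
    proof -
      have "finite S" "S \<noteq> {}" using that by (auto simp: V_iff intro: finite_subset)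
      then show ?thesis by (auto simp: Gamma_adj_def)
    qed
    then show "Kneser3_laplacian n vs = mat (length vs) (length vs)
        (\<lambda>(i, j). of_bool (vs ! i \<inter> vs ! j = {}) - deg * of_bool (vs ! i = vs ! j))"
      using dist unfolding Kneser3_laplacian_def Gamma_adj_mat_def deg_def
      by (intro eq_matI) (auto simp: nth_eq_iff_index_eq set_vs[symmetric])
  next
    fix b c e S assume mem: "(b, c, e) \<in> set xs" and "S \<in> set vs"
    have "Lap b = of_int e * c"
      using mem bk(1) bh(1) f(1) z(1) l1 l2 l3 unfolding xs_def block_def by fastforce
    then have "Lap b S = e * c S" by simp
    moreover have "Lap b S = (\<Sum>T\<in>V. (of_bool (S \<inter> T = {}) - deg * of_bool (S = T)) * b T)"
      using \<open>S \<in> set vs\<close> finite_V set_vs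
      by (simp add: Lap_def left_diff_distrib sum_subtractf mult.assoc flip: sum_distrib_left)
    ultimately show "(\<Sum>T\<in>set vs. (of_bool (S \<inter> T = {}) - deg * of_bool (S = T)) * b T) = e * c S"
      by (simp add: set_vs)
  next
    fix T assume "T \<in> set vs"
    then have T: "T \<in> V" by (simp add: set_vs)
    show "(\<lambda>U. of_bool (U = T)) \<in> zspan ((\<lambda>(b, c, e). b) ` set xs)"
      unfolding delta[OF T]
      by (rule cover[OF zmod.subspace_span blocks(1) T])
    show "(\<lambda>U. of_bool (U = T)) \<in> zspan ((\<lambda>(b, c, e). c) ` set xs)"
      unfolding delta[OF T]
      by (rule cover[OF zmod.subspace_span blocks(2) T])
  qed (use dist len_xs in auto)
  then obtain D where D: "diagonal_form (Kneser3_laplacian n vs) D" "diag_mat D = map (\<lambda>(b, c, e). e) xs"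
    by blast
  then have "image_mset rat_of_int (mset (diag_mat D)) = Kneser3_entries n"
    by (simp only: entries_eq[OF D1 D2] diag)
  with D(1) show ?thesis by blast
qed

end

theorem theorem5p13:
  fixes n :: nat and vs :: "nat set list"
  assumes "n \<ge> 7"
    and "Gamma_enum n 3 vs"
  shows "\<exists>D. diagonal_form (Kneser3_laplacian n vs) D \<and>
             image_mset rat_of_int (mset (diag_mat D)) = Kneser3_entries n"
proof -
  interpret kneser3 n by unfold_locales (rule assms(1))
  show ?thesis using assms(2) by (rule diagonal_form_exists)
qed

end
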